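(* Let $r\ge 2$ and let $\mathbb{X}$ be a finite set of points in $\mathbb{P}^1\times\cdots\times\mathbb{P}^1$ ($r$ times), and suppose that $\operatorname{depth}(R/I_{\mathbb{X}})=r-1$. If $H_{\mathbb{X}}$ is the Hilbert function of $\mathbb{X}$, then $\Delta H_{\mathbb{X}}$ is not the Hilbert function of an $\mathbb{N}^r$-graded artinian quotient of $k[x_{1,1},x_{2,1},\ldots,x_{r,1}]$.
   Context: $k$ is an algebraically closed field of characteristic zero, projective spaces are over $k$, and $\mathbb{N}=\{0,1,2,\ldots\}$. The coordinate ring of $\mathbb{P}^1\times\cdots\times\mathbb{P}^1$ ($r$ times) is the $\mathbb{N}^r$-graded ring $R=k[x_{1,0},x_{1,1},x_{2,0},x_{2,1},\ldots,x_{r,0},x_{r,1}]$ with $\deg x_{i,j}=e_i$, the $i$th standard basis vector of $\mathbb{N}^r$. $I_{\mathbb{X}}\subseteq R$ is the ideal generated by all multihomogeneous forms vanishing at all points of $\mathbb{X}$. Depth is taken with respect to the ideal generated by all the variables. For an $\mathbb{N}^r$-graded quotient $S$ of a polynomial ring by a multihomogeneous ideal, the Hilbert function is $H_S:\mathbb{N}^r\to\mathbb{N}$, $H_S(\underline{i})=\dim_k S_{\underline{i}}$; $H_{\mathbb{X}}:=H_{R/I_{\mathbb{X}}}$. The ring $k[x_{1,1},\ldots,x_{r,1}]$ is $\mathbb{N}^r$-graded by $\deg x_{i,1}=e_i$, and an $\mathbb{N}^r$-graded artinian quotient is an artinian quotient of it by a multihomogeneous ideal. For a function $H:\mathbb{N}^r\to\mathbb{N}$,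 the first difference function is $$\Delta H(\underline{i})=\sum_{\underline{0}\preceq\underline{l}=(l_1,\ldots,l_r)\preceq(1,\ldots,1)}(-1)^{|\underline{l}|}H(i_1-l_1,\ldots,i_r-l_r),$$ where $|\underline{l}|=l_1+\cdots+l_r$, $\preceq$ is the componentwise order, and $H(\underline{j})=0$ if $\underline{j}\not\succeq\underline{0}$. *)

theory Defs
  imports
    "HOL-Analysis.Analysis"
    "HOL-Library.Poly_Mapping"
    "HOL-Library.Extended_Nat"
    "HOL-Computational_Algebra.Computational_Algebra"
begin

section \<open>Polynomial rings and ideals\<close>

text \<open>Polynomials over \<open>'k\<close> in the variables \<open>'v\<close>: finitely supported functions on the monomials,
  which are themselves finitely supported exponent functions. The product is convolution.\<close>

type_synonym ('v, 'k) mpoly = "('v \<Rightarrow>\<^sub>0 nat) \<Rightarrow>\<^sub>0 'k"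

definition const :: "'k \<Rightarrow> ('v, 'k::comm_ring_1) mpoly" where
  "const c = Poly_Mapping.single 0 c"

definition var :: "'v \<Rightarrow> ('v, 'k::comm_ring_1) mpoly" where
  "var v = Poly_Mapping.single (Poly_Mapping.single v 1) 1"

definition eval :: "('v::finite, 'k::comm_ring_1) mpoly \<Rightarrow> ('v \<Rightarrow> 'k) \<Rightarrow> 'k" where
  "eval f a = (\<Sum>m\<in>Poly_Mapping.keys f.
     Poly_Mapping.lookup f m * (\<Prod>v\<in>UNIV. a v ^ Poly_Mapping.lookup m v))"

text \<open>A commutative ring is a module over itself; its submodules are the ideals and the
  submodule spanned by a set is the ideal generated by it.\<close>

lemma module_times: "module ((*) :: 'a::comm_ring_1 \<Rightarrow> 'a \<Rightarrow> 'a)"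
  by unfold_locales (simp_all add: algebra_simps)

definition is_ideal :: "'a::comm_ring_1 set \<Rightarrow> bool" where
  "is_ideal = module.subspace (*)"

definition ideal_gen :: "'a::comm_ring_1 set \<Rightarrow> 'a set" where
  "ideal_gen = module.span (*)"

section \<open>Multigradings and Hilbert functions\<close>

text \<open>A map \<open>g :: 'v \<Rightarrow> 'r\<close> encodes the grading by \<open>'r \<Rightarrow> nat\<close> in which the variable \<open>v\<close> has as
  degree the standard basis vector of index \<open>g v\<close>.\<close>

definition mdeg :: "('v::finite \<Rightarrow> 'r) \<Rightarrow> ('v \<Rightarrow>\<^sub>0 nat) \<Rightarrow> 'r \<Rightarrow> nat" where
  "mdeg g m = (\<lambda>i. \<Sum>v | g v = i. Poly_Mapping.lookup m v)"

definition forms :: "('v::finite \<Rightarrow> 'r) \<Rightarrow> ('r \<Rightarrow> nat) \<Rightarrow> ('v, 'k::comm_ring_1) mpoly set" where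
  "forms g d = {f. \<forall>m\<in>Poly_Mapping.keys f. mdeg g m = d}"

definition multihomogeneous_ideal ::
    "('v::finite \<Rightarrow> 'r) \<Rightarrow> ('v, 'k::comm_ring_1) mpoly set \<Rightarrow> bool" where
  "multihomogeneous_ideal g I \<longleftrightarrow> (\<exists>F \<subseteq> (\<Union>d. forms g d). I = ideal_gen F)"

text \<open>The residue classes modulo \<open>I\<close> of the elements of \<open>B\<close> are pairwise distinct and form a
  basis over \<open>'k\<close> of the image of \<open>V\<close> in the quotient by \<open>I\<close>.\<close>

definition basis_mod ::
    "('v, 'k::field) mpoly set \<Rightarrow> ('v, 'k) mpoly set \<Rightarrow> ('v, 'k) mpoly set \<Rightarrow> bool" where
  "basis_mod I V B \<longleftrightarrow> finite B \<and> B \<subseteq> V \<and>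
     (\<forall>c. (\<Sum>b\<in>B. const (c b) * b) \<in> I \<longrightarrow> (\<forall>b\<in>B. c b = 0)) \<and>
     (\<forall>f\<in>V. \<exists>c. f - (\<Sum>b\<in>B. const (c b) * b) \<in> I)"

text \<open>Hilbert function of the quotient by \<open>I\<close>; a finite basis exists in each degree because
  there are only finitely many variables.\<close>

definition hilbert_fun ::
    "('v::finite \<Rightarrow> 'r) \<Rightarrow> ('v, 'k::field) mpoly set \<Rightarrow> ('r \<Rightarrow> nat) \<Rightarrow> nat" where
  "hilbert_fun g I d = (THE n. \<exists>B. basis_mod I (forms g d) B \<and> card B = n)"

definition first_diff :: "(('r::finite \<Rightarrow> nat) \<Rightarrow> nat) \<Rightarrow> ('r \<Rightarrow> nat) \<Rightarrow> int" where
  "first_diff H i = (\<Sum>l\<in>{l. l \<le> (\<lambda>_. 1)}.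
     (-1) ^ (\<Sum>j\<in>UNIV. l j) * (if l \<le> i then int (H (\<lambda>j. i j - l j)) else 0))"

section \<open>Depth and the artinian property of quotients\<close>

text \<open>\<open>fs\<close> is a regular sequence on the quotient by \<open>I\<close>.\<close>

definition regular_seq :: "'a::comm_ring_1 set \<Rightarrow> 'a list \<Rightarrow> bool" where
  "regular_seq I fs \<longleftrightarrow>
     (\<forall>n<length fs. \<forall>g. fs ! n * g \<in> ideal_gen (I \<union> set (take n fs)) \<longrightarrow>
        g \<in> ideal_gen (I \<union> set (take n fs))) \<and>
     ideal_gen (I \<union> set fs) \<noteq> UNIV"

text \<open>Depth of the quotient by \<open>I\<close>, with respect to the ideal generated by all the variables.\<close>

definition depth :: "('v, 'k::comm_ring_1) mpoly set \<Rightarrow> enat" where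
  "depth I = (SUP fs\<in>{fs. set fs \<subseteq> ideal_gen (range var) \<and> regular_seq I fs}. enat (length fs))"

text \<open>Descending chain condition for the quotient by \<open>I\<close>, whose ideals correspond to the ideals
  containing \<open>I\<close>.\<close>

definition artinian_quotient :: "'a::comm_ring_1 set \<Rightarrow> bool" where
  "artinian_quotient I \<longleftrightarrow>
     (\<forall>C :: nat \<Rightarrow> 'a set.
        (\<forall>n. is_ideal (C n) \<and> I \<subseteq> C n \<and> C (Suc n) \<subseteq> C n) \<longrightarrow> (\<exists>N. \<forall>n\<ge>N. C n = C N))"

section \<open>Points in a product of projective lines\<close>

text \<open>The type \<open>2\<close> has the two elements \<open>0\<close> and \<open>1\<close>. A point of the projective line is a
  class of nonzero coordinate vectors up to scaling; \<open>'r\<close> indexes the factors of the product,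
  and \<open>(i, j)\<close> is the \<open>j\<close>-th homogeneous coordinate on the \<open>i\<close>-th factor.\<close>

definition proj_line :: "(2 \<Rightarrow> 'k::field) set set" where
  "proj_line = {v. v \<noteq> (\<lambda>_. 0)} //
     {(v, w). v \<noteq> (\<lambda>_. 0) \<and> (\<exists>c. c \<noteq> 0 \<and> w = (\<lambda>j. c * v j))}"

definition multiproj :: "('r \<Rightarrow> (2 \<Rightarrow> 'k::field) set) set" where
  "multiproj = {P. \<forall>i. P i \<in> proj_line}"

definition vanishes_at ::
    "('r::finite \<times> 2, 'k::field) mpoly \<Rightarrow> ('r \<Rightarrow> (2 \<Rightarrow> 'k) set) \<Rightarrow> bool" where
  "vanishes_at f P \<longleftrightarrow> (\<forall>p. (\<forall>i. p i \<in> P i) \<longrightarrow> eval f (\<lambda>(i, j). p i j) = 0)"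

definition vanishing_ideal ::
    "('r::finite \<Rightarrow> (2 \<Rightarrow> 'k::field) set) set \<Rightarrow> ('r \<times> 2, 'k) mpoly set" where
  "vanishing_ideal X = ideal_gen {f. (\<exists>d. f \<in> forms fst d) \<and> (\<forall>P\<in>X. vanishes_at f P)}"

definition hilbert_points ::
    "('r::finite \<Rightarrow> (2 \<Rightarrow> 'k::field) set) set \<Rightarrow> ('r \<Rightarrow> nat) \<Rightarrow> nat" where
  "hilbert_points X = hilbert_fun fst (vanishing_ideal X)"

end

theory Submission
  imports Defs
begin

text \<open>
  Let \<open>I\<close> be the ideal of the points and \<open>H\<close> the Hilbert function of \<open>R/I\<close>. If the first difference
  of \<open>H\<close> is the Hilbert function of an artinian quotient of \<open>k[y\<^sub>1, \<dots>, y\<^sub>r]\<close>, then \<open>R/I\<close> is a free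
  module over a polynomial subring generated by \<open>r\<close> linear forms. Those forms are then a regular
  sequence, so the depth of \<open>R/I\<close> is at least \<open>r\<close> and cannot be \<open>r - 1\<close>. The freeness comes from
  counting dimensions.

  Each graded piece of \<open>k[y\<^sub>1, \<dots>, y\<^sub>r]\<close> is one-dimensional, so the Hilbert function of an artinian
  quotient is the indicator function of a finite set \<open>E\<close> of degrees (lemma \<open>artinian_hilbert_fun\<close>).
  Inverting the difference operator gives \<open>H(d) = card {a \<in> E. a \<le> d}\<close> (lemmas \<open>first_diff_inject\<close> and
  \<open>first_diff_count\<close>). If \<open>b\<close> is not in \<open>E\<close>, this is less than \<open>card {a. a \<le> b}\<close>, which is the
  dimension of \<open>R\<close> in degree \<open>b\<close>; hence \<open>I\<close> contains a nonzero form \<open>F\<^sub>b\<close> of degree \<open>b\<close> (lemma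
  \<open>exists_form_in_ideal\<close>).

  As \<open>E\<close> lies in a box, every degree outside \<open>E\<close> is above a degree outside \<open>E\<close> in one fixed finite box.
  The field is infinite, so there is a point with coordinates \<open>(\<beta>\<^sub>v : 1)\<close> at which none of the
  finitely many forms \<open>F\<^sub>b\<close> with \<open>b\<close> in that box vanishes (lemma \<open>generic_point\<close>). Let
  \<open>L\<^sub>v = x\<^sub>v\<^sub>,\<^sub>0 - \<beta>\<^sub>v x\<^sub>v\<^sub>,\<^sub>1\<close> and \<open>y\<^sub>v = x\<^sub>v\<^sub>,\<^sub>1\<close>. Modulo the \<open>L\<^sub>v\<close> a form of degree \<open>b\<close> is its value at
  the point times \<open>y\<^sup>b\<close> (lemma \<open>form_reduction\<close>). So \<open>y\<^sup>i\<close> lies in \<open>I + (L\<^sub>1, \<dots>, L\<^sub>r)\<close> for all \<open>i\<close>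
  outside \<open>E\<close>, and a graded Nakayama argument shows that the \<open>y\<^sup>a\<close> with \<open>a \<in> E\<close> generate \<open>R/I\<close> over
  \<open>k[L\<^sub>1, \<dots>, L\<^sub>r]\<close> (lemma \<open>forms_spanned_by_adapted\<close>).

  In degree \<open>d\<close> this says that the products \<open>L\<^sup>d\<^sup>-\<^sup>a y\<^sup>a\<close> with \<open>a \<in> E\<close> and \<open>a \<le> d\<close> span. There are \<open>H(d)\<close> of
  them, which is the dimension, so they are linearly independent modulo \<open>I\<close> (lemma
  \<open>adapted_independent\<close>). Thus \<open>R/I\<close> is free over \<open>k[L\<^sub>1, \<dots>, L\<^sub>r]\<close>, and comparing coefficients shows that
  each \<open>L\<^sub>v\<close> is a nonzerodivisor modulo \<open>I\<close> and any set of the others (lemma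
  \<open>lform_nonzerodivisor\<close>).
\<close>

section \<open>Scalars and ideals\<close>

lemma const_add: "const (a + b) = const a + const b"
  by (simp add: const_def single_add)

lemma const_mult: "const (a * b) = const a * const b"
  by (simp add: const_def mult_single)

lemma const_0 [simp]: "const 0 = 0"
  by (simp add: const_def)

lemma const_1 [simp]: "const 1 = 1"
  by (simp add: const_def)

interpretation kvec: vector_space "\<lambda>(c::'k::field) (f::('v, 'k) mpoly). const c * f"
  by unfold_locales (simp_all add: const_add const_mult algebra_simps)

interpretation ideal: module "(*) :: 'a::comm_ring_1 \<Rightarrow> 'a \<Rightarrow> 'a"
  by (rule module_times)

text \<open>As simplification rules, these would turn \<open>a * (b * x)\<close> into \<open>(a * b) * x\<close> and loop with the
  associative and distributive rewriting used below.\<close>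

declare kvec.scale_scale [simp del] ideal.scale_scale [simp del]

lemma is_ideal_ideal_gen: "ideal.subspace (ideal_gen F)"
  by (simp add: ideal_gen_def)

lemma ideal_kspace: "ideal.subspace I \<Longrightarrow> kvec.subspace I"
  by (auto simp: kvec.subspace_def ideal.subspace_def)

lemma lookup_const_mult: "Poly_Mapping.lookup (const c * f) m = c * Poly_Mapping.lookup f m"
proof -
  have "const c * f = Poly_Mapping.map ((*) c) f"
    by (simp add: const_def mult_map_scale_conv_mult)
  then show ?thesis
    by (simp add: Poly_Mapping.map.rep_eq when_def)
qed

lemma sum_monomials:
  "(\<Sum>m\<in>Poly_Mapping.keys f. Poly_Mapping.single m (Poly_Mapping.lookup f m)) = f"
  by (rule poly_mapping_eqI)
    (simp add: lookup_sum lookup_single when_def in_keys_iff sum.delta)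

section \<open>Homogeneous components\<close>

lemma mdeg_add: "mdeg g (m + n) = (\<lambda>i. mdeg g m i + mdeg g n i)"
  by (simp add: mdeg_def lookup_add sum.distrib)

lemma kvec_subspace_forms: "kvec.subspace (forms g d)"
  by (auto simp: kvec.subspace_def forms_def in_keys_iff lookup_add lookup_const_mult)

lemma forms_mult: "f \<in> forms g d \<Longrightarrow> h \<in> forms g e \<Longrightarrow> f * h \<in> forms g (\<lambda>i. d i + e i)"
  using keys_mult[of f h] by (fastforce simp: forms_def mdeg_add)

lemma single_in_forms: "Poly_Mapping.single m c \<in> forms g (mdeg g m)"
  by (simp add: forms_def)

definition hom_comp ::
    "('v::finite \<Rightarrow> 'r) \<Rightarrow> ('r \<Rightarrow> nat) \<Rightarrow> ('v, 'k::comm_ring_1) mpoly \<Rightarrow> ('v, 'k) mpoly" where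
  "hom_comp g d f = (\<Sum>m | m \<in> Poly_Mapping.keys f \<and> mdeg g m = d.
     Poly_Mapping.single m (Poly_Mapping.lookup f m))"

lemma lookup_hom_comp:
  "Poly_Mapping.lookup (hom_comp g d f) m = (if mdeg g m = d then Poly_Mapping.lookup f m else 0)"
  by (simp add: hom_comp_def lookup_sum lookup_single when_def in_keys_iff)

lemma hom_comp_add: "hom_comp g d (f + h) = hom_comp g d f + hom_comp g d h"
  by (rule poly_mapping_eqI) (simp add: lookup_hom_comp lookup_add)

lemma hom_comp_diff: "hom_comp g d (f - h) = hom_comp g d f - hom_comp g d h"
  by (rule poly_mapping_eqI) (simp add: lookup_hom_comp lookup_minus)

lemma hom_comp_0 [simp]: "hom_comp g d 0 = 0"
  by (rule poly_mapping_eqI) (simp add: lookup_hom_comp)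

lemma hom_comp_sum: "hom_comp g d (\<Sum>x\<in>A. F x) = (\<Sum>x\<in>A. hom_comp g d (F x))"
  by (induction A rule: infinite_finite_induct) (simp_all add: hom_comp_add)

lemma hom_comp_form: "f \<in> forms g e \<Longrightarrow> hom_comp g d f = (if d = e then f else 0)"
  by (rule poly_mapping_eqI) (auto simp: lookup_hom_comp forms_def in_keys_iff)

text \<open>A generator of \<open>I\<close> may be multiplied by any polynomial; splitting the multiplier into monomials
  turns the product into a sum of forms in \<open>I\<close>, and a homogeneous component selects some of them.\<close>

lemma hom_comp_mem:
  assumes "multihomogeneous_ideal g I" and "f \<in> I"
  shows "hom_comp g d f \<in> I"
proof -
  obtain F where F: "F \<subseteq> (\<Union>d. forms g d)" and I: "I = ideal_gen F"
    using assms(1) by (auto simp: multihomogeneous_ideal_def)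
  have sub: "ideal.subspace I"
    unfolding I by (rule is_ideal_ideal_gen)
  have step: "hom_comp g d (c * x) \<in> I" if xF: "x \<in> F" for c x
  proof -
    obtain e where x: "x \<in> forms g e"
      using F xF by auto
    have "x \<in> I"
      using xF by (simp add: I ideal_gen_def ideal.span_base)
    have one: "hom_comp g d (Poly_Mapping.single m a * x) \<in> I" for m a
      using forms_mult[OF single_in_forms x, of m a] \<open>x \<in> I\<close> sub
      by (auto simp: hom_comp_form ideal.subspace_def)
    have "c * x = (\<Sum>m\<in>Poly_Mapping.keys c. Poly_Mapping.single m (Poly_Mapping.lookup c m) * x)"
      by (simp add: sum_monomials flip: sum_distrib_right)
    then show ?thesis
      using one sub by (simp add: hom_comp_sum ideal.subspace_sum)
  qed
  show ?thesis
    using assms(2) unfolding I ideal_gen_def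
  proof (induction rule: ideal.span_induct_alt)
    case base
    then show ?case by (simp add: ideal.span_zero)
  next
    case (step c x y)
    then show ?case
      using \<open>\<And>x c. x \<in> F \<Longrightarrow> hom_comp g d (c * x) \<in> I\<close>[of x c]
      by (simp add: hom_comp_add I ideal_gen_def ideal.span_add)
  qed
qed

lemma multihomogeneous_is_ideal: "multihomogeneous_ideal g I \<Longrightarrow> ideal.subspace I"
  using is_ideal_ideal_gen by (auto simp: multihomogeneous_ideal_def)

section \<open>Dimensions of graded pieces\<close>

lemma finite_mdeg: "finite {m :: 'v::finite \<Rightarrow>\<^sub>0 nat. mdeg g m = d}"
proof -
  let ?N = "\<Sum>v\<in>UNIV. d (g v)"
  have "Poly_Mapping.lookup m v \<le> ?N" if "mdeg g m = d" for m :: "'v \<Rightarrow>\<^sub>0 nat" and v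
  proof -
    have "Poly_Mapping.lookup m v \<le> mdeg g m (g v)"
      unfolding mdeg_def by (rule member_le_sum) auto
    also have "\<dots> \<le> ?N"
      unfolding that by (rule member_le_sum[of v UNIV "\<lambda>v. d (g v)"]) auto
    finally show ?thesis .
  qed
  then have "Poly_Mapping.lookup ` {m :: 'v \<Rightarrow>\<^sub>0 nat. mdeg g m = d} \<subseteq> PiE UNIV (\<lambda>_. {..?N})"
    by auto
  then have "finite (Poly_Mapping.lookup ` {m :: 'v \<Rightarrow>\<^sub>0 nat. mdeg g m = d})"
    by (rule finite_subset) (simp add: finite_PiE)
  then show ?thesis
    by (rule finite_imageD) (simp add: inj_on_def lookup_inject)
qed

definition monomials :: "('v::finite \<Rightarrow> 'r) \<Rightarrow> ('r \<Rightarrow> nat) \<Rightarrow> ('v, 'k::field) mpoly set" where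
  "monomials g d = (\<lambda>m. Poly_Mapping.single m 1) ` {m. mdeg g m = d}"

lemma finite_monomials: "finite (monomials g d)"
  by (simp add: monomials_def finite_mdeg)

lemma single_1_eq_iff:
  "Poly_Mapping.single m (1::'k::zero_neq_one) = Poly_Mapping.single n 1 \<longleftrightarrow> m = n"
proof
  assume "Poly_Mapping.single m (1::'k) = Poly_Mapping.single n 1"
  then have "Poly_Mapping.keys (Poly_Mapping.single m (1::'k)) = Poly_Mapping.keys (Poly_Mapping.single n (1::'k))"
    by simp
  then show "m = n" by simp
qed simp

lemma const_mult_single: "const c * Poly_Mapping.single m a = Poly_Mapping.single m (c * a)"
  by (simp add: const_def mult_single)

lemma forms_eq_span:
  "forms g d = (kvec.span (monomials g d) :: ('v::finite, 'k::field) mpoly set)"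
proof
  show "forms g d \<subseteq> (kvec.span (monomials g d) :: ('v, 'k) mpoly set)"
  proof
    fix f :: "('v, 'k) mpoly" assume f: "f \<in> forms g d"
    have "(\<Sum>m\<in>Poly_Mapping.keys f. const (Poly_Mapping.lookup f m) * Poly_Mapping.single m 1)
        \<in> kvec.span (monomials g d)"
      using f by (intro kvec.span_sum kvec.span_scale kvec.span_base)
        (auto simp: monomials_def forms_def)
    then show "f \<in> kvec.span (monomials g d)"
      by (simp add: const_mult_single sum_monomials)
  qed
  show "kvec.span (monomials g d) \<subseteq> (forms g d :: ('v, 'k) mpoly set)"
    by (rule kvec.span_minimal[OF _ kvec_subspace_forms])
      (auto simp: monomials_def forms_def)
qed

lemma independent_monomials: "kvec.independent (monomials g d :: ('v::finite, 'k::field) mpoly set)"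
proof -
  let ?M = "{m :: 'v \<Rightarrow>\<^sub>0 nat. mdeg g m = d}"
  let ?s = "\<lambda>m. Poly_Mapping.single m (1::'k)"
  have inj: "inj_on ?s ?M"
    by (auto simp: inj_on_def single_1_eq_iff)
  have "u (?s n) = 0"
    if "(\<Sum>b\<in>monomials g d. const (u b) * b) = (0 :: ('v, 'k) mpoly)" and "mdeg g n = d" for u n
  proof -
    have "0 = Poly_Mapping.lookup (\<Sum>b\<in>monomials g d. const (u b) * b) n"
      using that(1) by simp
    also have "\<dots> = (\<Sum>m\<in>?M. u (?s m) when m = n)"
      unfolding monomials_def
      by (simp add: sum.reindex[OF inj] lookup_sum lookup_const_mult lookup_single when_def
          if_distrib cong: if_cong)
    also have "\<dots> = u (?s n)"
      using that(2) finite_mdeg[of g d] by (simp add: when_def sum.delta)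
    finally show ?thesis by simp
  qed
  then show ?thesis
    unfolding kvec.dependent_finite[OF finite_monomials] by (auto simp: monomials_def)
qed

lemma dim_forms: "kvec.dim (forms g d :: ('v::finite, 'k::field) mpoly set)
    = card {m :: 'v \<Rightarrow>\<^sub>0 nat. mdeg g m = d}"
proof -
  have "kvec.dim (forms g d :: ('v, 'k) mpoly set) = card (monomials g d :: ('v, 'k) mpoly set)"
    by (simp add: forms_eq_span kvec.dim_eq_card_independent independent_monomials)
  also have "\<dots> = card {m :: 'v \<Rightarrow>\<^sub>0 nat. mdeg g m = d}"
    unfolding monomials_def by (rule card_image) (auto simp: inj_on_def single_1_eq_iff)
  finally show ?thesis .
qed

lemma independentD_finite:
  assumes "kvec.independent C" and "finite C" and "(\<Sum>b\<in>C. const (w b) * b) = 0" and "b \<in> C"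
  shows "w b = 0"
proof (rule ccontr)
  assume "w b \<noteq> 0"
  then have "\<exists>b\<in>C. w b \<noteq> 0"
    using assms(4) by (rule bexI)
  then have "kvec.dependent C"
    unfolding kvec.dependent_finite[OF assms(2)] using assms(3) by (intro exI[of _ w] conjI)
  then show False
    using assms(1) by contradiction
qed

lemma finite_independent_forms:
  assumes "kvec.independent B" and "B \<subseteq> forms g d"
  shows "finite B"
  using kvec.independent_span_bound[OF finite_monomials[of g d] assms(1)] assms(2)
  by (simp add: forms_eq_span)

text \<open>A basis of the graded piece modulo \<open>I\<close> and a basis of its intersection with \<open>I\<close> together form
  a basis of the graded piece. So all bases modulo \<open>I\<close> have the same cardinality, which is what gives
  the Hilbert function a value.\<close>

lemma basis_mod_card:
  fixes I B :: "('v::finite, 'k::field) mpoly set"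
  assumes I: "ideal.subspace I" and B: "basis_mod I (forms g d) B"
  shows "card B + kvec.dim (I \<inter> forms g d) = kvec.dim (forms g d :: ('v, 'k) mpoly set)"
proof -
  have finB: "finite B" and subB: "B \<subseteq> forms g d"
    and indB: "\<And>c. (\<Sum>b\<in>B. const (c b) * b) \<in> I \<Longrightarrow> \<forall>b\<in>B. c b = 0"
    and spanB: "\<And>f. f \<in> forms g d \<Longrightarrow> \<exists>c. f - (\<Sum>b\<in>B. const (c b) * b) \<in> I"
    using B by (auto simp: basis_mod_def)
  obtain A where A: "A \<subseteq> I \<inter> forms g d" "kvec.independent A" "I \<inter> forms g d \<subseteq> kvec.span A"
      "card A = kvec.dim (I \<inter> forms g d)"
    by (rule kvec.basis_exists)
  have finA: "finite A"
    using A finite_independent_forms by blast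
  have kI: "kvec.subspace I"
    by (rule ideal_kspace[OF I])
  have inI: "(\<Sum>b\<in>A. const (u b) * b) \<in> I" for u
    using A(1) kI by (intro kvec.subspace_sum kvec.subspace_scale) auto
  have disj: "A \<inter> B = {}"
  proof (rule ccontr)
    assume "A \<inter> B \<noteq> {}"
    then obtain b where b: "b \<in> A" "b \<in> B" by auto
    have "(\<Sum>x\<in>B. const (if x = b then 1 else 0) * x) = b"
      using b finB by (simp add: if_distrib if_distribR sum.delta cong: if_cong)
    then show False
      using bspec[OF indB[of "\<lambda>x. if x = b then 1 else 0"] b(2)] b A(1) by auto
  qed
  have "kvec.independent (A \<union> B)"
  proof -
    have "u b = 0" if "(\<Sum>b\<in>A \<union> B. const (u b) * b) = 0" and "b \<in> A \<union> B" for u b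
    proof -
      have eq: "(\<Sum>b\<in>B. const (u b) * b) = - (\<Sum>b\<in>A. const (u b) * b)"
        using that(1) finA finB disj by (simp add: sum.union_disjoint eq_neg_iff_add_eq_0 add.commute)
      have "(\<Sum>b\<in>B. const (u b) * b) \<in> I"
        unfolding eq by (rule kvec.subspace_neg[OF kI inI])
      then have uB: "\<forall>b\<in>B. u b = 0"
        by (rule indB)
      then have "(\<Sum>b\<in>A. const (u b) * b) = 0"
        using eq by simp
      then have "\<forall>b\<in>A. u b = 0"
        using A(2) finA by (auto simp: kvec.dependent_finite)
      then show ?thesis
        using uB that(2) by auto
    qed
    then show ?thesis
      using finA finB by (auto simp: kvec.dependent_finite)
  qed
  moreover have "forms g d \<subseteq> kvec.span (A \<union> B)"
  proof
    fix f :: "('v, 'k) mpoly" assume f: "f \<in> forms g d"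
    obtain c where c: "f - (\<Sum>b\<in>B. const (c b) * b) \<in> I"
      using spanB[OF f] by auto
    have "(\<Sum>b\<in>B. const (c b) * b) \<in> forms g d"
      using subB by (intro kvec.subspace_sum kvec.subspace_scale kvec_subspace_forms) auto
    then have "f - (\<Sum>b\<in>B. const (c b) * b) \<in> I \<inter> forms g d"
      using c f kvec.subspace_diff[OF kvec_subspace_forms] by auto
    then have "f - (\<Sum>b\<in>B. const (c b) * b) \<in> kvec.span (A \<union> B)"
      using A(3) kvec.span_mono[of A "A \<union> B"] by auto
    moreover have "(\<Sum>b\<in>B. const (c b) * b) \<in> kvec.span (A \<union> B)"
      by (intro kvec.span_sum kvec.span_scale kvec.span_base) auto
    ultimately show "f \<in> kvec.span (A \<union> B)"
      using kvec.span_add by fastforce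
  qed
  ultimately have "card (A \<union> B) = kvec.dim (forms g d :: ('v, 'k) mpoly set)"
    using A(1) subB by (intro kvec.basis_card_eq_dim) auto
  then show ?thesis
    using finA finB disj A(4) by (simp add: card_Un_disjoint)
qed

lemma basis_mod_exists:
  fixes I :: "('v::finite, 'k::field) mpoly set"
  assumes I: "ideal.subspace I"
  shows "\<exists>B. basis_mod I (forms g d) B"
proof -
  obtain A where A: "A \<subseteq> I \<inter> forms g d" "kvec.independent A" "I \<inter> forms g d \<subseteq> kvec.span A"
      "card A = kvec.dim (I \<inter> forms g d)"
    by (rule kvec.basis_exists)
  obtain C where C: "A \<subseteq> C" "C \<subseteq> forms g d" "kvec.independent C" "forms g d \<subseteq> kvec.span C"
    using kvec.maximal_independent_subset_extend[of A "forms g d"] A by auto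
  have finC: "finite C"
    using C finite_independent_forms by blast
  have finA: "finite A"
    using finC C(1) finite_subset by auto
  have kI: "kvec.subspace I"
    by (rule ideal_kspace[OF I])
  have inI: "(\<Sum>b\<in>A. const (u b) * b) \<in> I" for u
    using A(1) kI by (intro kvec.subspace_sum kvec.subspace_scale) auto
  have split: "(\<Sum>b\<in>C. const (u b) * b) =
      (\<Sum>b\<in>C - A. const (u b) * b) + (\<Sum>b\<in>A. const (u b) * b)" for u
    using sum.subset_diff[OF C(1) finC] by auto
  have "basis_mod I (forms g d) (C - A)"
    unfolding basis_mod_def
  proof (intro conjI allI impI ballI)
    show "finite (C - A)" using finC by simp
    show "C - A \<subseteq> forms g d" using C by auto
  next
    fix c b assume c: "(\<Sum>b\<in>C - A. const (c b) * b) \<in> I" and b: "b \<in> C - A"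
    have "(\<Sum>b\<in>C - A. const (c b) * b) \<in> forms g d"
      using C(2) by (intro kvec.subspace_sum kvec.subspace_scale kvec_subspace_forms) auto
    then have "(\<Sum>b\<in>C - A. const (c b) * b) \<in> kvec.span A"
      using c A(3) by auto
    then obtain u where u: "(\<Sum>b\<in>C - A. const (c b) * b) = (\<Sum>b\<in>A. const (u b) * b)"
      using kvec.span_finite[OF finA] by auto
    let ?w = "\<lambda>b. if b \<in> A then - u b else c b"
    have neg: "const (- u b) = - const (u b)" for b
      by (simp add: const_def single_uminus)
    have "(\<Sum>b\<in>A. const (?w b) * b) = - (\<Sum>b\<in>A. const (u b) * b)"
      by (simp add: neg sum_negf)
    moreover have "(\<Sum>b\<in>C - A. const (?w b) * b) = (\<Sum>b\<in>C - A. const (c b) * b)"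
      by (rule sum.cong) auto
    ultimately have "(\<Sum>b\<in>C. const (?w b) * b) = 0"
      unfolding split using u by simp
    then have "?w b = 0"
      using b by (intro independentD_finite[OF C(3) finC]) auto
    then show "c b = 0"
      using b by auto
  next
    fix f :: "('v, 'k) mpoly" assume "f \<in> forms g d"
    then obtain u where u: "f = (\<Sum>b\<in>C. const (u b) * b)"
      using C(4) kvec.span_finite[OF finC] by auto
    show "\<exists>c. f - (\<Sum>b\<in>C - A. const (c b) * b) \<in> I"
      using inI by (intro exI[of _ u]) (simp add: u split)
  qed
  then show ?thesis by blast
qed

text \<open>The Hilbert function is accessed only through this equation between dimensions of subspaces of
  the polynomial ring, so that the library's linear algebra applies to it.\<close>

lemma hilbert_fun_add_dim:
  fixes I :: "('v::finite, 'k::field) mpoly set"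
  assumes "ideal.subspace I"
  shows "hilbert_fun g I d + kvec.dim (I \<inter> forms g d) = kvec.dim (forms g d :: ('v, 'k) mpoly set)"
proof -
  obtain B where B: "basis_mod I (forms g d) B"
    using basis_mod_exists[OF assms] by blast
  have "hilbert_fun g I d = card B"
    unfolding hilbert_fun_def
  proof (rule the_equality)
    show "\<exists>B'. basis_mod I (forms g d) B' \<and> card B' = card B"
      using B by blast
    show "n = card B" if "\<exists>B'. basis_mod I (forms g d) B' \<and> card B' = n" for n
      using that basis_mod_card[OF assms, of g d] basis_mod_card[OF assms B]
      by (metis add_right_imp_eq)
  qed
  then show ?thesis
    using basis_mod_card[OF assms B] by simp
qed


section \<open>Difference functions of finite sets\<close>

lemma cube_eq_PiE: "{l :: 'r \<Rightarrow> nat. l \<le> (\<lambda>_. 1)} = PiE UNIV (\<lambda>_. {0, 1})"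
  by (auto simp: le_fun_def PiE_def Pi_def) (metis le_Suc_eq le_zero_eq One_nat_def)+

lemma finite_le_fun: "finite {a :: 'r::finite \<Rightarrow> nat. a \<le> i}"
proof -
  have "{a. a \<le> i} = PiE UNIV (\<lambda>v. {..i v})"
    by (auto simp: le_fun_def)
  then show ?thesis
    by (simp add: finite_PiE)
qed

text \<open>The value at \<open>i\<close> is the term \<open>l = 0\<close> of the difference at \<open>i\<close>, and all other terms involve
  smaller degrees only. So a function can be recovered recursively from its difference function.\<close>

lemma first_diff_inject:
  assumes "\<And>i. first_diff H i = first_diff G i"
  shows "H i = G i"
proof (induction "\<Sum>v\<in>UNIV. i v" arbitrary: i rule: less_induct)
  case less
  let ?C = "{l :: 'a \<Rightarrow> nat. l \<le> (\<lambda>_. 1)}"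
  let ?t = "\<lambda>F l. (-1) ^ (\<Sum>j\<in>UNIV. l j) * (if l \<le> i then int (F (\<lambda>j. i j - l j)) else 0)"
  have fin: "finite ?C" by (rule finite_le_fun)
  have zero: "(\<lambda>_. 0) \<in> ?C" by (simp add: le_fun_def)
  have expand: "first_diff F i = int (F i) + (\<Sum>l\<in>?C - {\<lambda>_. 0}. ?t F l)" for F
    unfolding first_diff_def by (subst sum.remove[OF fin zero]) (simp add: le_fun_def)
  have "?t H l = ?t G l" if l: "l \<in> ?C - {\<lambda>_. 0}" for l
  proof (cases "l \<le> i")
    case True
    obtain v where v: "l v \<noteq> 0" using l by auto
    have "(\<Sum>v\<in>UNIV. i v - l v) < (\<Sum>v\<in>UNIV. i v)"
    proof (rule sum_strict_mono_ex1)
      show "\<exists>a\<in>UNIV. i a - l a < i a"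
        using v True by (intro bexI[of _ v]) (auto simp: le_fun_def intro!: diff_less dest: spec[of _ v])
    qed auto
    then show ?thesis using less by simp
  qed simp
  then have "(\<Sum>l\<in>?C - {\<lambda>_. 0}. ?t H l) = (\<Sum>l\<in>?C - {\<lambda>_. 0}. ?t G l)"
    by (rule sum.cong[OF refl])
  then show ?case
    using expand[of H] expand[of G] assms[of i] by simp
qed

text \<open>Exchanging the sums, each \<open>a \<in> E\<close> contributes an alternating sum over the cube that is a product
  of one-variable differences of the step functions \<open>a v \<le> i v\<close>; it is 1 if \<open>a = i\<close> and 0 otherwise.\<close>

lemma first_diff_count:
  fixes E :: "('r::finite \<Rightarrow> nat) set"
  assumes "finite E"
  shows "first_diff (\<lambda>i. card {a\<in>E. a \<le> i}) i = (if i \<in> E then 1 else 0)"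
proof -
  let ?C = "PiE (UNIV :: 'r set) (\<lambda>_. {0, 1 :: nat})"
  let ?s = "\<lambda>a v (y::nat). (-1) ^ y * (if y + a v \<le> i v then 1 else 0 :: int)"
  have summand: "(-1) ^ (\<Sum>v\<in>UNIV. l v) * (if l \<le> i then int (card {a\<in>E. a \<le> (\<lambda>v. i v - l v)}) else 0)
      = (\<Sum>a\<in>E. \<Prod>v\<in>UNIV. ?s a v (l v))" for l :: "'r \<Rightarrow> nat"
  proof -
    have iff: "l \<le> i \<and> a \<le> (\<lambda>v. i v - l v) \<longleftrightarrow> (\<forall>v. l v + a v \<le> i v)" for a
      unfolding le_fun_def by (metis add_leD1 le_diff_conv2 add.commute)
    have "(if l \<le> i then int (card {a\<in>E. a \<le> (\<lambda>v. i v - l v)}) else 0)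
        = (\<Sum>a\<in>E. if \<forall>v. l v + a v \<le> i v then 1 else 0)"
      using assms iff by (auto simp: sum.If_cases Int_def conj_commute intro!: arg_cong[where f = card])
    also have "\<dots> = (\<Sum>a\<in>E. \<Prod>v\<in>UNIV. if l v + a v \<le> i v then 1 else 0)"
      by (intro sum.cong refl) (auto simp: prod_zero_iff)
    finally show ?thesis
      by (simp add: sum_distrib_left prod.distrib power_sum)
  qed
  have one: "(\<Sum>y\<in>{0,1}. ?s a v y) = (if a v = i v then 1 else 0)" for a v
    by auto
  have "first_diff (\<lambda>i. card {a\<in>E. a \<le> i}) i = (\<Sum>l\<in>?C. \<Sum>a\<in>E. \<Prod>v\<in>UNIV. ?s a v (l v))"
    by (simp only: first_diff_def cube_eq_PiE summand)
  also have "\<dots> = (\<Sum>a\<in>E. \<Sum>l\<in>?C. \<Prod>v\<in>UNIV. ?s a v (l v))"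
    by (rule sum.swap)
  also have "\<dots> = (\<Sum>a\<in>E. \<Prod>v\<in>UNIV. \<Sum>y\<in>{0,1}. ?s a v y)"
    by (intro sum.cong refl prod_sum_PiE[symmetric]) auto
  also have "\<dots> = (\<Sum>a\<in>E. \<Prod>v\<in>UNIV. if a v = i v then 1 else 0)"
    by (simp only: one)
  also have "\<dots> = (\<Sum>a\<in>E. if a = i then 1 else 0)"
    by (intro sum.cong refl) (auto simp: prod_zero_iff fun_eq_iff)
  also have "\<dots> = (if i \<in> E then 1 else 0)"
    using assms by (simp add: sum.delta)
  finally show ?thesis .
qed

section \<open>Artinian quotients of a polynomial ring in one variable per degree\<close>

lemma monomial_split:
  fixes m n :: "'v::finite \<Rightarrow>\<^sub>0 nat"
  assumes "\<And>v. Poly_Mapping.lookup n v \<le> Poly_Mapping.lookup m v"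
  obtains m' where "m = m' + n"
proof
  show "m = Poly_Mapping.Abs_poly_mapping
      (\<lambda>v. Poly_Mapping.lookup m v - Poly_Mapping.lookup n v) + n"
    using assms by (intro poly_mapping_eqI) (simp add: lookup_add)
qed

lemma var_power: "var v ^ n = Poly_Mapping.single (Poly_Mapping.single v n) 1"
  by (induction n) (simp_all add: var_def mult_single flip: single_add)

lemma dim_forms_id: "kvec.dim (forms id d :: ('r::finite, 'k::field) mpoly set) = 1"
proof -
  have "{m :: 'r \<Rightarrow>\<^sub>0 nat. mdeg id m = d} = {Poly_Mapping.Abs_poly_mapping d}"
    by (auto simp: mdeg_def lookup_inverse intro!: poly_mapping_eqI)
  then show ?thesis by (simp add: dim_forms)
qed

text \<open>The descending chain of the ideals \<open>J + (y\<^sup>n)\<close>, for one variable \<open>y\<close>, becomes stationary, so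
  \<open>y\<^sup>N - h y\<^sup>N\<^sup>+\<^sup>1\<close> is in \<open>J\<close> for some \<open>N\<close> and \<open>h\<close>. Its component in the degree of \<open>y\<^sup>N\<close> is \<open>y\<^sup>N\<close>.\<close>

lemma artinian_var_power:
  fixes J :: "('r::finite, 'k::field) mpoly set"
  assumes "multihomogeneous_ideal id J" and "artinian_quotient J"
  shows "\<exists>N. var v ^ N \<in> J"
proof -
  define C where "C n = ideal_gen (insert (var v ^ n) J)" for n
  have J: "ideal.subspace J"
    using assms(1) by (rule multihomogeneous_is_ideal)
  have "is_ideal (C n)" "J \<subseteq> C n" for n
    using ideal.span_superset[of "insert (var v ^ n) J"]
    by (auto simp: C_def is_ideal_def is_ideal_ideal_gen ideal_gen_def)
  moreover have "C (Suc n) \<subseteq> C n" for n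
    unfolding C_def ideal_gen_def
  proof (rule ideal.span_minimal)
    have "var v * var v ^ n \<in> ideal.span (insert (var v ^ n) J)"
      by (intro ideal.span_scale ideal.span_base) simp
    then show "insert (var v ^ Suc n) J \<subseteq> ideal.span (insert (var v ^ n) J)"
      by (auto intro: ideal.span_base)
  qed simp
  ultimately obtain N where N: "\<forall>n\<ge>N. C n = C N"
    using assms(2) unfolding artinian_quotient_def by meson
  have "C (Suc N) = C N"
    by (rule N[rule_format]) simp
  moreover have "var v ^ N \<in> C N"
    by (auto simp: C_def ideal_gen_def intro: ideal.span_base)
  ultimately have "var v ^ N \<in> ideal.span (insert (var v ^ Suc N) J)"
    by (simp add: C_def ideal_gen_def)
  then obtain h where "var v ^ N - h * var v ^ Suc N \<in> ideal.span J"
    by (auto simp: ideal.span_breakdown_eq)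
  then have h: "var v ^ N - h * var v ^ Suc N \<in> J"
    using ideal.span_minimal[OF subset_refl J] by blast
  let ?d = "mdeg id (Poly_Mapping.single v N) :: 'r \<Rightarrow> nat"
  have "mdeg id m \<noteq> ?d" if m: "m \<in> Poly_Mapping.keys (h * var v ^ Suc N)" for m :: "'r \<Rightarrow>\<^sub>0 nat"
  proof
    assume "mdeg id m = ?d"
    then have "Poly_Mapping.lookup m v = N"
      by (auto simp: mdeg_def fun_eq_iff dest!: spec[of _ v])
    moreover obtain a where "m = a + Poly_Mapping.single v (Suc N)"
      using m keys_mult[of h "var v ^ Suc N"] unfolding var_power by auto
    ultimately show False by (simp add: lookup_add)
  qed
  then have "hom_comp id ?d (h * var v ^ Suc N) = 0"
    by (intro poly_mapping_eqI) (auto simp: lookup_hom_comp in_keys_iff)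
  moreover have "hom_comp id ?d (var v ^ N) = (var v ^ N :: ('r, 'k) mpoly)"
    by (simp add: var_power hom_comp_form[OF single_in_forms])
  ultimately show ?thesis
    using hom_comp_mem[OF assms(1) h, of ?d] by (auto simp: hom_comp_diff)
qed

lemma forms_id_subset:
  fixes J :: "('r::finite, 'k::field) mpoly set"
  assumes J: "ideal.subspace J" and N: "var v ^ N \<in> J" and i: "N \<le> i v"
  shows "forms id i \<subseteq> J"
proof
  fix f :: "('r, 'k) mpoly" assume f: "f \<in> forms id i"
  have "Poly_Mapping.single m c \<in> J" if "mdeg id m = i" for m c
  proof -
    have "Poly_Mapping.lookup m v = i v"
      using that by (auto simp: mdeg_def fun_eq_iff)
    then have "Poly_Mapping.lookup (Poly_Mapping.single v N) w \<le> Poly_Mapping.lookup m w" for w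
      using i by (auto simp: lookup_single when_def)
    then obtain m' where m': "m = m' + Poly_Mapping.single v N"
      by (rule monomial_split)
    have "Poly_Mapping.single m c = Poly_Mapping.single m' c * var v ^ N"
      by (simp add: var_power mult_single m')
    then show ?thesis
      using J N by (simp add: ideal.subspace_def)
  qed
  then have "(\<Sum>m\<in>Poly_Mapping.keys f. Poly_Mapping.single m (Poly_Mapping.lookup f m)) \<in> J"
    using f by (intro ideal.subspace_sum[OF J]) (auto simp: forms_def)
  then show "f \<in> J" by (simp add: sum_monomials)
qed

text \<open>With one variable in each degree the graded pieces are lines, so the Hilbert function takes
  the values 0 and 1 only. It vanishes in each degree whose monomial is divisible by a power of a variable
  that lies in \<open>J\<close>.\<close>

lemma artinian_hilbert_fun:
  fixes J :: "('r::finite, 'k::field) mpoly set"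
  assumes "multihomogeneous_ideal id J" and "artinian_quotient J"
  shows "finite {i. hilbert_fun id J i \<noteq> 0}" and "hilbert_fun id J i \<le> 1"
proof -
  have J: "ideal.subspace J"
    using assms(1) by (rule multihomogeneous_is_ideal)
  have sum: "hilbert_fun id J i + kvec.dim (J \<inter> forms id i) = 1" for i
    using hilbert_fun_add_dim[OF J, of id i] by (simp add: dim_forms_id)
  then show "hilbert_fun id J i \<le> 1"
    by (metis le_add1)
  have "\<forall>v. \<exists>N. var v ^ N \<in> J"
    using artinian_var_power[OF assms] by auto
  then obtain N where N: "\<And>v. var v ^ N v \<in> J"
    by metis
  have "i \<le> N" if "hilbert_fun id J i \<noteq> 0" for i
  proof (rule ccontr)
    assume "\<not> i \<le> N"
    then obtain v where "N v \<le> i v"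
      by (auto simp: le_fun_def not_le intro: less_imp_le)
    then have "J \<inter> forms id i = forms id i"
      using forms_id_subset[OF J N] by auto
    then show False
      using sum[of i] that by (simp add: dim_forms_id)
  qed
  then show "finite {i. hilbert_fun id J i \<noteq> 0}"
    by (intro finite_subset[OF _ finite_le_fun[of N]]) auto
qed

section \<open>A point at which finitely many forms do not vanish\<close>

text \<open>Kronecker's substitution: the weights are powers of \<open>N + 1\<close>, and a tuple of digits up to \<open>N\<close> is
  determined by the number that it represents in base \<open>N + 1\<close>.\<close>

lemma kronecker_weights:
  assumes "finite A"
  shows "\<exists>w :: 'a \<Rightarrow> nat. \<forall>m m'. (\<forall>i\<in>A. m i \<le> N \<and> m' i \<le> N) \<and>
    (\<Sum>i\<in>A. w i * m i) = (\<Sum>i\<in>A. w i * m' i) \<longrightarrow> (\<forall>i\<in>A. m i = m' i)"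
  using assms
proof induction
  case empty
  then show ?case by simp
next
  case (insert a A)
  then obtain w where w: "\<And>m m'. (\<forall>i\<in>A. m i \<le> N \<and> m' i \<le> N) \<Longrightarrow>
      (\<Sum>i\<in>A. w i * m i) = (\<Sum>i\<in>A. w i * m' i) \<Longrightarrow> (\<forall>i\<in>A. m i = m' i)"
    by blast
  define w' where "w' i = (if i = a then 1 else Suc N * w i)" for i
  have eq: "(\<Sum>i\<in>insert a A. w' i * m i) = m a + Suc N * (\<Sum>i\<in>A. w i * m i)" for m
  proof -
    have "(\<Sum>i\<in>A. w' i * m i) = (\<Sum>i\<in>A. Suc N * (w i * m i))"
      using insert.hyps by (intro sum.cong) (auto simp: w'_def algebra_simps)
    then show ?thesis
      using insert.hyps by (simp add: w'_def sum_distrib_left)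
  qed
  show ?case
  proof (intro exI[of _ w'] allI impI)
    fix m m' assume *: "(\<forall>i\<in>insert a A. m i \<le> N \<and> m' i \<le> N) \<and>
      (\<Sum>i\<in>insert a A. w' i * m i) = (\<Sum>i\<in>insert a A. w' i * m' i)"
    then have e: "m a + Suc N * (\<Sum>i\<in>A. w i * m i) = m' a + Suc N * (\<Sum>i\<in>A. w i * m' i)"
      unfolding eq by simp
    have "m a < Suc N" "m' a < Suc N" using * by auto
    then have "m a = m' a"
      using e by (metis mod_less mod_mult_self2)
    moreover from this e have "(\<Sum>i\<in>A. w i * m i) = (\<Sum>i\<in>A. w i * m' i)"
      by (metis add_left_cancel mult_cancel1 nat.distinct(1))
    then have "\<forall>i\<in>A. m i = m' i"
      using * by (intro w) auto
    ultimately show "\<forall>i\<in>insert a A. m i = m' i" by simp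
  qed
qed

lemma UNIV_2_eq: "(UNIV :: 2 set) = {0, 1}"
  by (rule card_subset_eq[symmetric]) auto

text \<open>The point with homogeneous coordinates \<open>(\<beta> v : 1)\<close> on the factor \<open>v\<close>.\<close>

definition affine_pt :: "('r \<Rightarrow> 'k::field) \<Rightarrow> 'r \<times> 2 \<Rightarrow> 'k" where
  "affine_pt \<beta> = (\<lambda>(v, j). if j = 0 then \<beta> v else 1)"

definition mono_val :: "('r \<Rightarrow> 'k::field) \<Rightarrow> ('r::finite \<times> 2 \<Rightarrow>\<^sub>0 nat) \<Rightarrow> 'k" where
  "mono_val \<beta> m = (\<Prod>p\<in>UNIV. affine_pt \<beta> p ^ Poly_Mapping.lookup m p)"

lemma prod_pairs: "(\<Prod>p\<in>(UNIV :: ('r::finite \<times> 2) set). F p) = (\<Prod>v\<in>UNIV. F (v, 0) * F (v, 1))"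
proof -
  have "(\<Prod>p\<in>(UNIV :: ('r \<times> 2) set). F p) = (\<Prod>v\<in>UNIV. \<Prod>j\<in>UNIV. F (v, j))"
    by (simp add: prod.cartesian_product)
  then show ?thesis by (simp add: UNIV_2_eq)
qed

lemma mono_val_eq: "mono_val \<beta> m = (\<Prod>v\<in>UNIV. \<beta> v ^ Poly_Mapping.lookup m (v, 0))"
  by (simp add: mono_val_def prod_pairs affine_pt_def)

lemma eval_affine_pt: "eval f (affine_pt \<beta>) =
    (\<Sum>m\<in>Poly_Mapping.keys f. Poly_Mapping.lookup f m * mono_val \<beta> m)"
  by (simp add: eval_def mono_val_def)

lemma mdeg_fst: "mdeg fst m = (\<lambda>v. Poly_Mapping.lookup m (v, 0) + Poly_Mapping.lookup m (v, 1))"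
  for m :: "'r::finite \<times> 2 \<Rightarrow>\<^sub>0 nat"
proof
  fix v
  have "{p :: 'r \<times> 2. fst p = v} = {(v, 0), (v, 1)}"
    using UNIV_2_eq by auto
  then show "mdeg fst m v = Poly_Mapping.lookup m (v, 0) + Poly_Mapping.lookup m (v, 1)"
    by (simp add: mdeg_def)
qed

text \<open>The exponents of the coordinates with index 0 and the multidegree determine those of the
  coordinates with index 1. So distinct monomials of a form stay distinct at the points \<open>affine_pt\<close>.\<close>

lemma mdeg_fst_eqI:
  fixes m n :: "'r::finite \<times> 2 \<Rightarrow>\<^sub>0 nat"
  assumes "mdeg fst m = mdeg fst n" and "\<And>v. Poly_Mapping.lookup m (v, 0) = Poly_Mapping.lookup n (v, 0)"
  shows "m = n"
proof (rule poly_mapping_eqI)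
  fix p :: "'r \<times> 2"
  obtain v j where p: "p = (v, j)" by force
  have "j = 0 \<or> j = 1" using UNIV_2_eq by auto
  then show "Poly_Mapping.lookup m p = Poly_Mapping.lookup n p"
    using assms by (auto simp: mdeg_fst fun_eq_iff p)
qed

text \<open>On the curve \<open>\<beta> v = t ^ w v\<close> with Kronecker weights \<open>w\<close>, distinct monomials of a form become
  distinct powers of \<open>t\<close>. So the nonzero forms become nonzero polynomials in one variable, and \<open>t\<close> has
  only to avoid the finitely many roots of their product.\<close>

lemma generic_point:
  fixes B :: "('r::finite \<times> 2, 'k::field_char_0) mpoly set"
  assumes fin: "finite B"
    and B: "\<And>f. f \<in> B \<Longrightarrow> f \<noteq> 0 \<and> (\<exists>d. f \<in> forms fst d \<and> (\<forall>v. d v \<le> N))"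
  shows "\<exists>\<beta>. \<forall>f\<in>B. eval f (affine_pt \<beta>) \<noteq> 0"
proof -
  obtain w :: "'r \<Rightarrow> nat" where w: "\<And>m m'. (\<forall>i\<in>UNIV. m i \<le> N \<and> m' i \<le> N) \<Longrightarrow>
      (\<Sum>i\<in>UNIV. w i * m i) = (\<Sum>i\<in>UNIV. w i * m' i) \<Longrightarrow> (\<forall>i\<in>UNIV. m i = m' i)"
    using kronecker_weights[of "UNIV :: 'r set" N] finite by blast
  define wt where "wt m = (\<Sum>v\<in>UNIV. w v * Poly_Mapping.lookup m (v, 0))" for m :: "'r \<times> 2 \<Rightarrow>\<^sub>0 nat"
  define P where "P f = (\<Sum>m\<in>Poly_Mapping.keys f. monom (Poly_Mapping.lookup f m) (wt m))"
    for f :: "('r \<times> 2, 'k) mpoly"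
  have P_eval: "poly (P f) t = eval f (affine_pt (\<lambda>v. t ^ w v))" for f t
    unfolding P_def eval_affine_pt poly_sum poly_monom mono_val_eq wt_def
    by (simp add: power_sum power_mult)
  have P_nz: "P f \<noteq> 0" if fB: "f \<in> B" for f
  proof -
    obtain d where f: "f \<noteq> 0" "f \<in> forms fst d" and d: "\<And>v. d v \<le> N"
      using B[OF fB] by auto
    obtain n where n: "n \<in> Poly_Mapping.keys f"
      using f(1) by (metis keys_eq_empty ex_in_conv)
    have le: "Poly_Mapping.lookup m (v, 0) \<le> N" if "m \<in> Poly_Mapping.keys f" for m v
    proof -
      have "mdeg fst m v = d v" using f(2) that by (auto simp: forms_def)
      then show ?thesis using d[of v] by (simp add: mdeg_fst)
    qed
    have "m = n" if m: "m \<in> Poly_Mapping.keys f" and "wt m = wt n" for m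
    proof (rule mdeg_fst_eqI)
      show "mdeg fst m = mdeg fst n" using f(2) m n by (simp add: forms_def)
      show "Poly_Mapping.lookup m (v, 0) = Poly_Mapping.lookup n (v, 0)" for v
        using w[of "\<lambda>v. Poly_Mapping.lookup m (v, 0)" "\<lambda>v. Poly_Mapping.lookup n (v, 0)"]
          le[OF m] le[OF n] that(2) by (simp add: wt_def)
    qed
    then have "coeff (P f) (wt n) = (\<Sum>m\<in>Poly_Mapping.keys f. if m = n then Poly_Mapping.lookup f m else 0)"
      unfolding P_def coeff_sum coeff_monom by (intro sum.cong) auto
    also have "\<dots> = Poly_Mapping.lookup f n"
      using n by (simp add: sum.delta)
    finally show ?thesis using n by (auto simp: in_keys_iff)
  qed
  have "prod P B \<noteq> 0"
    using P_nz fin by (simp add: prod_zero_iff)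
  then have "finite {t. poly (prod P B) t = 0}"
    by (rule poly_roots_finite)
  then obtain t where "poly (prod P B) t \<noteq> 0"
    using ex_new_if_finite[OF infinite_UNIV_char_0] by blast
  then have "\<forall>f\<in>B. eval f (affine_pt (\<lambda>v. t ^ w v)) \<noteq> 0"
    using fin by (simp add: poly_prod prod_zero_iff P_eval)
  then show ?thesis by blast
qed

section \<open>Linear forms through a chosen point\<close>

text \<open>On the factor \<open>v\<close>, \<open>lform \<beta> v\<close> is the linear form that vanishes at the point \<open>affine_pt \<beta>\<close>; with
  \<open>var (v, 1)\<close> it spans the linear forms of that factor.\<close>

definition lform :: "('r \<Rightarrow> 'k::field) \<Rightarrow> 'r \<Rightarrow> ('r \<times> 2, 'k) mpoly" where
  "lform \<beta> v = var (v, 0) - const (\<beta> v) * var (v, 1)"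

definition ypow :: "('r::finite \<Rightarrow> nat) \<Rightarrow> ('r \<times> 2, 'k::field) mpoly" where
  "ypow d = (\<Prod>v\<in>UNIV. var (v, 1) ^ d v)"

text \<open>The pair \<open>(c, a)\<close> stands for \<open>L\<^sup>c y\<^sup>a\<close>, where \<open>L\<^sub>v = lform \<beta> v\<close> and \<open>y\<^sub>v = var (v, 1)\<close>.\<close>

definition adapted :: "('r \<Rightarrow> 'k::field) \<Rightarrow> ('r::finite \<Rightarrow> nat) \<times> ('r \<Rightarrow> nat) \<Rightarrow> ('r \<times> 2, 'k) mpoly" where
  "adapted \<beta> p = (\<Prod>v\<in>UNIV. lform \<beta> v ^ fst p v) * ypow (snd p)"

text \<open>The degree \<open>d\<close> piece of the ideal generated by all \<open>lform \<beta> v\<close>. The cofactors \<open>h\<close> are required to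
  be forms, so that an induction on the degree can be applied to them.\<close>

definition lform_part :: "('r::finite \<Rightarrow> 'k::field) \<Rightarrow> ('r \<Rightarrow> nat) \<Rightarrow> ('r \<times> 2, 'k) mpoly set" where
  "lform_part \<beta> d = kvec.span {lform \<beta> v * h | v h e. h \<in> forms fst e \<and> d = e(v := Suc (e v))}"

lemma one_in_forms: "1 \<in> forms g (\<lambda>_. 0)"
  by (simp add: forms_def mdeg_def)

lemma forms_power: "f \<in> forms g d \<Longrightarrow> f ^ n \<in> forms g (\<lambda>i. n * d i)"
  by (induction n) (auto simp: one_in_forms dest: forms_mult)

lemma forms_prod:
  "finite A \<Longrightarrow> (\<And>x. x \<in> A \<Longrightarrow> F x \<in> forms g (D x)) \<Longrightarrow> prod F A \<in> forms g (\<lambda>i. \<Sum>x\<in>A. D x i)"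
  by (induction A rule: finite_induct) (auto simp: one_in_forms intro: forms_mult)

lemma mdeg_fst_single: "mdeg fst (Poly_Mapping.single (v, j) n) = (\<lambda>u. if u = v then n else 0)"
  for v :: "'r::finite" and j :: 2
proof -
  have "j = 0 \<or> j = 1" using UNIV_2_eq by auto
  then show ?thesis by (auto simp: mdeg_fst lookup_single when_def)
qed

lemma var_in_forms: "var (v, j) \<in> forms fst (\<lambda>u. if u = v then 1 else 0)"
  for v :: "'r::finite" and j :: 2
  using mdeg_fst_single[of v j 1] by (simp add: var_def forms_def)

lemma lform_in_forms: "lform \<beta> v \<in> forms fst (\<lambda>u. if u = v then 1 else 0)"
  for v :: "'r::finite"
  unfolding lform_def
  by (intro kvec.subspace_diff kvec.subspace_scale kvec_subspace_forms var_in_forms)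

lemma sum_unit: "(\<Sum>v\<in>UNIV. d v * (if u = v then 1 else 0)) = d u"
  for d :: "'r::finite \<Rightarrow> nat"
  by (simp add: if_distrib cong: if_cong)

lemma prod_power_in_forms:
  fixes F :: "'r::finite \<Rightarrow> ('r \<times> 2, 'k::field) mpoly"
  assumes "\<And>v. F v \<in> forms fst (\<lambda>u. if u = v then 1 else 0)"
  shows "(\<Prod>v\<in>UNIV. F v ^ d v) \<in> forms fst d"
proof -
  have "(\<Prod>v\<in>UNIV. F v ^ d v) \<in> forms fst (\<lambda>u. \<Sum>v\<in>UNIV. d v * (if u = v then 1 else 0))"
    using assms by (intro forms_prod forms_power) auto
  then show ?thesis by (simp only: sum_unit)
qed

lemma ypow_in_forms: "ypow d \<in> forms fst d"
  unfolding ypow_def by (intro prod_power_in_forms var_in_forms)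

lemma adapted_in_forms: "adapted \<beta> p \<in> forms fst (\<lambda>v. fst p v + snd p v)"
proof -
  have "(\<Prod>v\<in>UNIV. lform \<beta> v ^ fst p v) \<in> forms fst (fst p)"
    by (intro prod_power_in_forms lform_in_forms)
  then show ?thesis
    unfolding adapted_def by (rule forms_mult[OF _ ypow_in_forms])
qed

lemma ypow_add: "ypow (\<lambda>v. d v + e v) = ypow d * ypow e"
  by (simp add: ypow_def power_add prod.distrib)

lemma adapted_0: "adapted \<beta> (\<lambda>_. 0, a) = ypow a"
  by (simp add: adapted_def)

lemma lform_mult_adapted: "lform \<beta> v * adapted \<beta> (c, a) = adapted \<beta> (c(v := Suc (c v)), a)"
proof -
  have "(\<Prod>u\<in>UNIV. lform \<beta> u ^ (c(v := Suc (c v))) u)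
      = (\<Prod>u\<in>UNIV. (if u = v then lform \<beta> v else 1) * lform \<beta> u ^ c u)"
    by (rule prod.cong) auto
  also have "\<dots> = lform \<beta> v * (\<Prod>u\<in>UNIV. lform \<beta> u ^ c u)"
    by (simp add: prod.distrib prod.delta)
  finally show ?thesis by (simp only: adapted_def fst_conv snd_conv mult.assoc)
qed

lemma lform_part_mult_ypow:
  assumes "f \<in> lform_part \<beta> d"
  shows "f * ypow e \<in> lform_part \<beta> (\<lambda>v. d v + e v)"
  using assms unfolding lform_part_def
proof (induction rule: kvec.span_induct_alt)
  case base
  then show ?case by (simp add: kvec.span_zero)
next
  case (step c x y)
  then obtain v h e' where x: "x = lform \<beta> v * h" "h \<in> forms fst e'" "d = e'(v := Suc (e' v))"
    by auto
  have "lform \<beta> v * (h * ypow e) \<in> lform_part \<beta> (\<lambda>v. d v + e v)"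
    unfolding lform_part_def
    using forms_mult[OF x(2) ypow_in_forms[of e]] x(3)
    by (intro kvec.span_base CollectI exI conjI) (auto simp: fun_eq_iff)
  then have "const c * (lform \<beta> v * (h * ypow e)) + y * ypow e \<in> lform_part \<beta> (\<lambda>v. d v + e v)"
    using step.IH unfolding lform_part_def by (intro kvec.span_add kvec.span_scale)
  then show ?case
    by (simp only: lform_part_def x(1) distrib_right mult.assoc)
qed

lemma single_eq_prod_var: "Poly_Mapping.single m 1 = (\<Prod>p\<in>UNIV. var p ^ Poly_Mapping.lookup m p :: ('v, 'k::comm_ring_1) mpoly)"
  for m :: "'v::finite \<Rightarrow>\<^sub>0 nat"
proof -
  have "(\<Prod>p\<in>A. var p ^ Poly_Mapping.lookup m p)
      = Poly_Mapping.single (\<Sum>p\<in>A. Poly_Mapping.single p (Poly_Mapping.lookup m p)) (1 :: 'k)"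
    if "finite A" for A
    using that by (induction A) (simp_all add: var_power mult_single)
  moreover have "(\<Sum>p\<in>UNIV. Poly_Mapping.single p (Poly_Mapping.lookup m p)) = m"
    by (rule poly_mapping_eqI) (simp add: lookup_sum lookup_single when_def)
  ultimately show ?thesis by simp
qed

lemma single_add_1: "Poly_Mapping.single (m + Poly_Mapping.single p 1) 1
    = (var p * Poly_Mapping.single m 1 :: ('v, 'k::comm_ring_1) mpoly)"
  by (simp add: var_def mult_single add.commute)

text \<open>Replacing one factor \<open>var (v, 0)\<close> by \<open>lform \<beta> v + const (\<beta> v) * var (v, 1)\<close> changes the monomial
  by an element of \<open>lform_part\<close> and lowers the exponent of \<open>var (v, 0)\<close>; the coefficients \<open>\<beta> v\<close> collected
  on the way make up the value of the monomial at the point.\<close>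

lemma monomial_reduction:
  fixes \<beta> :: "'r::finite \<Rightarrow> 'k::field"
  shows "Poly_Mapping.single m 1 - const (mono_val \<beta> m) * ypow (mdeg fst m) \<in> lform_part \<beta> (mdeg fst m)"
proof (induction "\<Sum>v\<in>UNIV. Poly_Mapping.lookup m (v, 0)" arbitrary: m)
  case 0
  then have "\<And>v. Poly_Mapping.lookup m (v, 0) = 0" by simp
  then have "Poly_Mapping.single m 1 = (ypow (mdeg fst m) :: ('r \<times> 2, 'k) mpoly)" "mono_val \<beta> m = 1"
    by (simp_all add: single_eq_prod_var prod_pairs ypow_def mdeg_fst mono_val_eq)
  then show ?case by (simp add: lform_part_def kvec.span_zero)
next
  case (Suc n)
  then obtain v where v: "Poly_Mapping.lookup m (v, 0) \<noteq> 0"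
    by (metis nat.distinct(1) sum.neutral)
  then have "Poly_Mapping.lookup (Poly_Mapping.single (v, 0) 1) p \<le> Poly_Mapping.lookup m p" for p
    by (auto simp: lookup_single when_def)
  then obtain m' where m: "m = m' + Poly_Mapping.single (v, 0) 1"
    by (rule monomial_split)
  let ?m = "m' + Poly_Mapping.single (v, 1) 1"
  let ?s = "\<lambda>m. Poly_Mapping.single m 1 :: ('r \<times> 2, 'k) mpoly"
  have deg: "mdeg fst ?m = mdeg fst m" "mdeg fst m = (mdeg fst m')(v := Suc (mdeg fst m' v))"
    unfolding m mdeg_add mdeg_fst_single by auto
  have val: "mono_val \<beta> m = \<beta> v * mono_val \<beta> ?m"
  proof -
    have "mono_val \<beta> m = mono_val \<beta> m' * (\<Prod>u\<in>UNIV. if u = v then \<beta> v else 1)"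
      unfolding mono_val_eq m prod.distrib[symmetric]
      by (intro prod.cong) (auto simp: lookup_add lookup_single when_def)
    moreover have "mono_val \<beta> ?m = mono_val \<beta> m'"
      unfolding mono_val_eq by (intro prod.cong) (auto simp: lookup_add lookup_single when_def)
    ultimately show ?thesis by simp
  qed
  have "(\<Sum>u\<in>UNIV. Poly_Mapping.lookup m (u, 0)) = Suc (\<Sum>u\<in>UNIV. Poly_Mapping.lookup ?m (u, 0))"
    by (simp add: m lookup_add lookup_single when_def sum.distrib)
  then have "?s ?m - const (mono_val \<beta> ?m) * ypow (mdeg fst ?m) \<in> lform_part \<beta> (mdeg fst ?m)"
    using Suc.hyps by simp
  then have IH: "?s ?m - const (mono_val \<beta> ?m) * ypow (mdeg fst m) \<in> lform_part \<beta> (mdeg fst m)"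
    unfolding deg .
  have "lform \<beta> v * ?s m' \<in> lform_part \<beta> (mdeg fst m)"
    unfolding lform_part_def using deg(2) single_in_forms
    by (intro kvec.span_base CollectI exI conjI) auto
  moreover have "?s m - const (mono_val \<beta> m) * ypow (mdeg fst m) = lform \<beta> v * ?s m'
      + const (\<beta> v) * (?s ?m - const (mono_val \<beta> ?m) * ypow (mdeg fst m))"
    unfolding val const_mult single_add_1 lform_def by (subst (1) m) (simp only: single_add_1 algebra_simps)
  ultimately show ?case
    using IH unfolding lform_part_def by (simp add: kvec.span_add kvec.span_scale)
qed

text \<open>Setting all \<open>L\<^sub>v\<close> to 0 is evaluation at the point, up to the power of the \<open>y\<^sub>v\<close> that restores
  the degree.\<close>

lemma form_reduction:
  assumes "f \<in> forms fst d"
  shows "f - const (eval f (affine_pt \<beta>)) * ypow d \<in> lform_part \<beta> d"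
proof -
  let ?c = "Poly_Mapping.lookup f"
  have const_sum: "const (sum F A) = (\<Sum>x\<in>A. const (F x))" for F :: "'c \<Rightarrow> 'b" and A
    by (induction A rule: infinite_finite_induct) (simp_all add: const_add)
  have "f - const (eval f (affine_pt \<beta>)) * ypow d = (\<Sum>m\<in>Poly_Mapping.keys f.
      Poly_Mapping.single m (?c m) - const (?c m * mono_val \<beta> m) * ypow d)"
    by (simp add: sum_subtractf sum_monomials eval_affine_pt sum_distrib_right const_sum)
  also have "\<dots> = (\<Sum>m\<in>Poly_Mapping.keys f.
      const (?c m) * (Poly_Mapping.single m 1 - const (mono_val \<beta> m) * ypow d))"
    by (intro sum.cong refl)
      (simp only: right_diff_distrib const_mult const_mult_single mult.assoc mult_1_right)
  also have "\<dots> \<in> lform_part \<beta> d"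
    using assms monomial_reduction[of _ \<beta>] unfolding lform_part_def
    by (intro kvec.span_sum kvec.span_scale) (fastforce simp: forms_def)
  finally show ?thesis .
qed

section \<open>Generation over the linear forms\<close>

definition adapted_set :: "('r \<Rightarrow> 'k::field) \<Rightarrow> ('r::finite \<Rightarrow> nat) set \<Rightarrow> ('r \<Rightarrow> nat) \<Rightarrow> ('r \<times> 2, 'k) mpoly set" where
  "adapted_set \<beta> E d = {adapted \<beta> (c, a) | c a. a \<in> E \<and> d = (\<lambda>v. c v + a v)}"

text \<open>A form of \<open>I\<close> of degree \<open>b \<le> i\<close> that does not vanish at the point equals a nonzero constant
  times \<open>y\<^sup>b\<close> modulo the \<open>L\<^sub>v\<close>. Solving for \<open>y\<^sup>b\<close> and multiplying by \<open>y\<^sup>i\<^sup>-\<^sup>b\<close> rewrites \<open>y\<^sup>i\<close>.\<close>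

lemma ypow_reduction:
  fixes I :: "('r::finite \<times> 2, 'k::field) mpoly set"
  assumes I: "ideal.subspace I" and "b \<le> i" and f: "f \<in> I" "f \<in> forms fst b" "eval f (affine_pt \<beta>) \<noteq> 0"
  obtains p q where "ypow i = p + q" and "p \<in> I" and "q \<in> lform_part \<beta> i"
proof
  let ?c = "eval f (affine_pt \<beta>)"
  let ?e = "\<lambda>v. i v - b v"
  have i: "i = (\<lambda>v. b v + ?e v)"
    using \<open>b \<le> i\<close> by (auto simp: le_fun_def)
  have inv: "const (1 / ?c) * const ?c = (1 :: ('r \<times> 2, 'k) mpoly)"
    using f(3) by (simp flip: const_mult)
  let ?n = "f - const ?c * ypow b"
  have "f - ?n = const ?c * ypow b" by simp
  then have "const (1 / ?c) * ((f - ?n) * ypow ?e) = const (1 / ?c) * const ?c * (ypow b * ypow ?e)"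
    by (simp only: mult.assoc)
  also have "\<dots> = ypow i"
    by (subst i) (simp add: inv ypow_add)
  finally have "ypow i = const (1 / ?c) * ((f - ?n) * ypow ?e)"
    by (rule sym)
  moreover have "k * ((f - n) * y) = k * y * f + - (k * (n * y))" for k n y :: "('r \<times> 2, 'k) mpoly"
    by (simp add: algebra_simps)
  ultimately show "ypow i = const (1 / ?c) * ypow ?e * f + - (const (1 / ?c) * (?n * ypow ?e))"
    by simp
  show "const (1 / ?c) * ypow ?e * f \<in> I"
    using I f(1) by (simp add: ideal.subspace_def)
  have "?n * ypow ?e \<in> lform_part \<beta> i"
    using lform_part_mult_ypow[OF form_reduction[OF f(2)], of \<beta> ?e] by (subst i)
  then show "- (const (1 / ?c) * (?n * ypow ?e)) \<in> lform_part \<beta> i"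
    unfolding lform_part_def by (intro kvec.span_neg kvec.span_scale)
qed

text \<open>The graded Nakayama lemma, by induction on the total degree. A form is a multiple of \<open>y\<^sup>d\<close> plus
  a combination of products \<open>L\<^sub>v h\<close>. The induction hypothesis applies to the cofactors \<open>h\<close>, and \<open>y\<^sup>d\<close> is
  either in the spanning set or, for \<open>d \<notin> E\<close>, itself reducible to products \<open>L\<^sub>v h\<close> modulo \<open>I\<close>.\<close>

lemma forms_spanned_by_adapted:
  fixes I :: "('r::finite \<times> 2, 'k::field) mpoly set"
  assumes I: "ideal.subspace I"
    and gen: "\<And>i. i \<notin> E \<Longrightarrow>
      \<exists>b f. b \<le> i \<and> f \<in> I \<and> f \<in> forms fst b \<and> eval f (affine_pt \<beta>) \<noteq> 0"
  shows "forms fst d \<subseteq> kvec.span (I \<union> adapted_set \<beta> E d)"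
proof (induction "\<Sum>v\<in>UNIV. d v" arbitrary: d rule: less_induct)
  case less
  let ?Z = "\<lambda>d. kvec.span (I \<union> adapted_set \<beta> E d)"
  have lift: "lform \<beta> v * h \<in> ?Z (e(v := Suc (e v)))" if "h \<in> ?Z e" for v h e
    using that
  proof (induction rule: kvec.span_induct_alt)
    case base
    then show ?case by (simp add: kvec.span_zero)
  next
    case (step c x y)
    have "lform \<beta> v * x \<in> I \<union> adapted_set \<beta> E (e(v := Suc (e v)))"
    proof (cases "x \<in> I")
      case True
      then show ?thesis using I by (simp add: ideal.subspace_def)
    next
      case False
      then obtain c a where x: "x = adapted \<beta> (c, a)" "a \<in> E" and e: "e = (\<lambda>v. c v + a v)"
        using step.hyps by (auto simp: adapted_set_def)
      have "e(v := Suc (e v)) = (\<lambda>u. (c(v := Suc (c v))) u + a u)"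
        by (auto simp: e)
      then have "lform \<beta> v * x \<in> adapted_set \<beta> E (e(v := Suc (e v)))"
        unfolding adapted_set_def x(1) lform_mult_adapted using x(2) by blast
      then show ?thesis ..
    qed
    then have "const c * (lform \<beta> v * x) + lform \<beta> v * y \<in> ?Z (e(v := Suc (e v)))"
      by (rule kvec.span_add[OF kvec.span_scale[OF kvec.span_base] step.IH])
    also have "const c * (lform \<beta> v * x) + lform \<beta> v * y = lform \<beta> v * (const c * x + y)"
      by (simp add: algebra_simps)
    finally show ?case .
  qed
  have part: "lform_part \<beta> d \<subseteq> ?Z d"
    unfolding lform_part_def
  proof (rule kvec.span_minimal[OF _ kvec.subspace_span], clarify)
    fix v e and h :: "('r \<times> 2, 'k) mpoly" assume h: "h \<in> forms fst e" and d: "d = e(v := Suc (e v))"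
    have "(\<Sum>u\<in>UNIV. e u) < (\<Sum>u\<in>UNIV. d u)"
      unfolding d by (intro sum_strict_mono_ex1) auto
    then have "h \<in> ?Z e"
      using less h by auto
    then show "lform \<beta> v * h \<in> ?Z (e(v := Suc (e v)))"
      by (rule lift)
  qed
  have y: "ypow d \<in> ?Z d"
  proof (cases "d \<in> E")
    case True
    then have "ypow d \<in> adapted_set \<beta> E d"
      unfolding adapted_set_def by (intro CollectI exI[of _ "\<lambda>_. 0"] exI[of _ d]) (simp add: adapted_0)
    then show ?thesis by (intro kvec.span_base) simp
  next
    case False
    then obtain b f where "b \<le> d" "f \<in> I" "f \<in> forms fst b" "eval f (affine_pt \<beta>) \<noteq> 0"
      using gen by blast
    then obtain p q where "ypow d = p + q" "p \<in> I" "q \<in> lform_part \<beta> d"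
      using ypow_reduction[OF I] by blast
    then show ?thesis
      using part by (auto intro!: kvec.span_add intro: kvec.span_base)
  qed
  show ?case
  proof
    fix f :: "('r \<times> 2, 'k) mpoly" assume f: "f \<in> forms fst d"
    have "(f - const (eval f (affine_pt \<beta>)) * ypow d) + const (eval f (affine_pt \<beta>)) * ypow d \<in> ?Z d"
      using form_reduction[OF f, of \<beta>] part y by (intro kvec.span_add kvec.span_scale) auto
    then show "f \<in> ?Z d" by simp
  qed
qed

section \<open>Freeness over the linear forms\<close>

text \<open>A set that spans a graded piece modulo \<open>I\<close> has at least as many elements as the Hilbert function
  says. Used with a set that is too small, this gives the linear independence below.\<close>

lemma hilbert_fun_le_card:
  fixes I S :: "('v::finite, 'k::field) mpoly set"
  assumes I: "ideal.subspace I" and S: "finite S" "S \<subseteq> forms g d"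
    and sp: "forms g d \<subseteq> kvec.span (I \<union> S)"
  shows "hilbert_fun g I d \<le> card S"
proof -
  obtain A where A: "A \<subseteq> I \<inter> forms g d" "kvec.independent A" "I \<inter> forms g d \<subseteq> kvec.span A"
      "card A = kvec.dim (I \<inter> forms g d)"
    by (rule kvec.basis_exists)
  have finA: "finite A"
    using A finite_independent_forms by blast
  have spanI: "kvec.span I = I"
    using ideal_kspace[OF I] by (simp add: kvec.span_eq_iff)
  have "forms g d \<subseteq> kvec.span (A \<union> S)"
  proof
    fix f :: "('v, 'k) mpoly" assume f: "f \<in> forms g d"
    then obtain x y where xy: "f = x + y" "x \<in> I" "y \<in> kvec.span S"
      using sp spanI unfolding kvec.span_Un by blast
    have "y \<in> forms g d"
      using xy(3) S(2) kvec.span_minimal[OF _ kvec_subspace_forms] by blast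
    then have "x \<in> forms g d"
      using f kvec.subspace_diff[OF kvec_subspace_forms, of f g d y] by (simp add: xy(1))
    then have "x \<in> kvec.span A"
      using xy(2) A(3) by auto
    then show "f \<in> kvec.span (A \<union> S)"
      unfolding kvec.span_Un using xy by blast
  qed
  then have "kvec.dim (forms g d :: ('v, 'k) mpoly set) \<le> card (A \<union> S)"
    using finA S(1) by (intro kvec.dim_le_card) auto
  also have "\<dots> \<le> card A + card S"
    by (rule card_Un_le)
  finally show ?thesis
    using hilbert_fun_add_dim[OF I, of g d] A(4) by simp
qed

lemma span_image_sum:
  assumes "y \<in> kvec.span (F ` P)"
  obtains K u where "finite K" and "K \<subseteq> P" and "y = (\<Sum>p\<in>K. const (u p) * F p)"
proof -
  obtain t r where t: "finite t" "t \<subseteq> F ` P" and y: "y = (\<Sum>b\<in>t. const (r b) * b)"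
    using assms unfolding kvec.span_explicit by auto
  obtain K where K: "K \<subseteq> P" "inj_on F K" "t = F ` K"
    using t(2) by (auto simp: subset_image_inj)
  show thesis
  proof (rule that)
    show "finite K" using t(1) K finite_image_iff by auto
    show "y = (\<Sum>p\<in>K. const (r (F p)) * F p)"
      using K by (simp add: y sum.reindex)
  qed (fact K(1))
qed

text \<open>The situation after the choice of the point \<open>\<beta>\<close>: the Hilbert function counts the elements of \<open>E\<close>
  below a degree, and the products \<open>L\<^sup>c y\<^sup>a\<close> with \<open>a \<in> E\<close> span \<open>R/I\<close>.\<close>

locale adapted_quotient =
  fixes I :: "('r::finite \<times> 2, 'k::field) mpoly set" and E :: "('r \<Rightarrow> nat) set" and \<beta> :: "'r \<Rightarrow> 'k"
  assumes multihom: "multihomogeneous_ideal fst I"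
    and proper: "I \<noteq> UNIV"
    and finite_E: "finite E"
    and hilbert: "\<And>d. hilbert_fun fst I d = card {a\<in>E. a \<le> d}"
    and spanned: "\<And>d. forms fst d \<subseteq> kvec.span (I \<union> adapted_set \<beta> E d)"
begin

lemma ideal_I: "ideal.subspace I"
  using multihom by (rule multihomogeneous_is_ideal)

lemma span_I: "kvec.span I = I"
  using ideal_kspace[OF ideal_I] by (simp add: kvec.span_eq_iff)

lemma I_mult: "f \<in> I \<Longrightarrow> h * f \<in> I"
  using ideal_I by (simp add: ideal.subspace_def)

text \<open>In one degree \<open>d\<close> the pair \<open>(c, a)\<close> is determined by \<open>a\<close>, so there are \<open>card {a \<in> E. a \<le> d}\<close>
  products. If a relation modulo \<open>I\<close> had a nonzero coefficient, its component in the degree of that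
  term would allow the term to be omitted from the spanning set, leaving fewer elements than the
  Hilbert function requires.\<close>

lemma adapted_independent:
  assumes K: "finite K" "K \<subseteq> UNIV \<times> E" and sum: "(\<Sum>p\<in>K. const (u p) * adapted \<beta> p) \<in> I"
    and p: "p \<in> K"
  shows "u p = 0"
proof (rule ccontr)
  assume u: "u p \<noteq> 0"
  obtain c0 a0 where p_def: "p = (c0, a0)" by force
  define d where "d = (\<lambda>v. c0 v + a0 v)"
  define T where "T = {p\<in>K. (\<lambda>v. fst p v + snd p v) = d}"
  let ?F = "\<lambda>a. adapted \<beta> (\<lambda>v. d v - a v, a)"
  define S where "S = ?F ` ({a\<in>E. a \<le> d} - {a0})"
  have a0: "a0 \<in> {a\<in>E. a \<le> d}"
    using K(2) p by (auto simp: p_def d_def le_fun_def)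
  have comp: "hom_comp fst d (const (u p) * adapted \<beta> p)
      = (if (\<lambda>v. fst p v + snd p v) = d then const (u p) * adapted \<beta> p else 0)" for p
    by (subst hom_comp_form[OF kvec.subspace_scale[OF kvec_subspace_forms adapted_in_forms]]) auto
  \<comment> \<open>As \<open>I\<close> is multihomogeneous, the terms of degree \<open>d\<close> satisfy a relation of their own.\<close>
  have "hom_comp fst d (\<Sum>p\<in>K. const (u p) * adapted \<beta> p) \<in> I"
    by (rule hom_comp_mem[OF multihom sum])
  also have "hom_comp fst d (\<Sum>p\<in>K. const (u p) * adapted \<beta> p) = (\<Sum>p\<in>T. const (u p) * adapted \<beta> p)"
    unfolding hom_comp_sum comp T_def using K(1) by (simp add: sum.inter_filter)
  also have "\<dots> = const (u p) * adapted \<beta> p + (\<Sum>p\<in>T - {p}. const (u p) * adapted \<beta> p)"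
    using K(1) p by (intro sum.remove) (auto simp: T_def p_def d_def)
  finally have "const (u p) * adapted \<beta> p + (\<Sum>p\<in>T - {p}. const (u p) * adapted \<beta> p) \<in> kvec.span (I \<union> S)"
    by (intro kvec.span_base) simp
  moreover have "adapted \<beta> q \<in> S" if q: "q \<in> T - {p}" for q
  proof -
    have dq: "d v = fst q v + snd q v" for v
      using q by (auto simp: T_def fun_eq_iff)
    have c: "fst q = (\<lambda>v. d v - snd q v)" and le: "snd q \<le> d" and "snd q \<in> E"
      using q K(2) by (auto simp: T_def le_fun_def dq)
    moreover have "snd q \<noteq> a0"
    proof
      assume "snd q = a0"
      moreover have "c0 = (\<lambda>v. d v - a0 v)" by (simp add: d_def)
      ultimately have "q = p" using c by (simp add: p_def prod_eq_iff)
      then show False using q by simp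
    qed
    moreover have "adapted \<beta> q = ?F (snd q)"
      by (rule arg_cong[where f = "adapted \<beta>"], rule prod_eqI) (simp_all only: c fst_conv snd_conv)
    ultimately show ?thesis by (simp add: S_def)
  qed
  then have "(\<Sum>p\<in>T - {p}. const (u p) * adapted \<beta> p) \<in> kvec.span (I \<union> S)"
    by (intro kvec.span_sum kvec.span_scale kvec.span_base) auto
  ultimately have "const (u p) * adapted \<beta> p \<in> kvec.span (I \<union> S)"
    by (simp add: kvec.span_add_eq2)
  then have "const (1 / u p) * (const (u p) * adapted \<beta> p) \<in> kvec.span (I \<union> S)"
    by (rule kvec.span_scale)
  then have p_in: "adapted \<beta> p \<in> kvec.span (I \<union> S)"
    using u by (simp flip: mult.assoc const_mult)
  have "adapted_set \<beta> E d \<subseteq> kvec.span (I \<union> S)"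
  proof
    fix x assume "x \<in> adapted_set \<beta> E d"
    then obtain c a where x: "x = adapted \<beta> (c, a)" "a \<in> E" and d: "d = (\<lambda>v. c v + a v)"
      by (auto simp: adapted_set_def)
    have c: "c = (\<lambda>v. d v - a v)" and le: "a \<le> d"
      by (auto simp: d le_fun_def)
    show "x \<in> kvec.span (I \<union> S)"
    proof (cases "a = a0")
      case True
      moreover have "c0 = (\<lambda>v. d v - a0 v)" by (simp add: d_def)
      ultimately show ?thesis using p_in c x(1) by (simp add: p_def)
    next
      case False
      then have "x \<in> S" using x c le by (auto simp: S_def)
      then show ?thesis by (intro kvec.span_base) simp
    qed
  qed
  then have "kvec.span (I \<union> adapted_set \<beta> E d) \<subseteq> kvec.span (I \<union> S)"
    by (intro kvec.span_minimal) (auto intro: kvec.span_base)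
  then have "forms fst d \<subseteq> kvec.span (I \<union> S)"
    using spanned[of d] by blast
  moreover have "S \<subseteq> forms fst d"
  proof
    fix x assume "x \<in> S"
    then obtain a where "a \<le> d" "x = ?F a" by (auto simp: S_def)
    moreover from this have "(\<lambda>v. d v - a v + a v) = d" by (auto simp: le_fun_def)
    ultimately show "x \<in> forms fst d"
      using adapted_in_forms[of \<beta> "(\<lambda>v. d v - a v, a)"] by simp
  qed
  moreover have "finite S"
    using finite_E by (simp add: S_def)
  ultimately have "hilbert_fun fst I d \<le> card S"
    using ideal_I by (intro hilbert_fun_le_card)
  also have "\<dots> \<le> card ({a\<in>E. a \<le> d} - {a0})"
    unfolding S_def using finite_E by (intro card_image_le) simp
  also have "\<dots> < card {a\<in>E. a \<le> d}"
    using finite_E a0 by (intro card_Diff1_less) auto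
  finally show False by (simp add: hilbert)
qed

lemma spanned_UNIV: "f \<in> kvec.span (I \<union> adapted \<beta> ` (UNIV \<times> E))"
proof -
  have "Poly_Mapping.single m (Poly_Mapping.lookup f m) \<in> kvec.span (I \<union> adapted \<beta> ` (UNIV \<times> E))" for m
  proof -
    have "I \<union> adapted_set \<beta> E (mdeg fst m) \<subseteq> I \<union> adapted \<beta> ` (UNIV \<times> E)"
      by (auto simp: adapted_set_def)
    then show ?thesis
      using spanned[of "mdeg fst m"] single_in_forms[of m _ fst] kvec.span_mono by blast
  qed
  then have "(\<Sum>m\<in>Poly_Mapping.keys f. Poly_Mapping.single m (Poly_Mapping.lookup f m))
      \<in> kvec.span (I \<union> adapted \<beta> ` (UNIV \<times> E))"
    by (intro kvec.span_sum)
  then show ?thesis by (simp add: sum_monomials)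
qed

text \<open>The ideal generated by \<open>I\<close> and the \<open>L\<^sub>u\<close> with \<open>u \<in> U\<close> has a description in terms of the basis:
  modulo \<open>I\<close> it is spanned by the products in which some \<open>L\<^sub>u\<close> occurs.\<close>

lemma ideal_gen_lforms_subset:
  "ideal_gen (I \<union> lform \<beta> ` U) \<subseteq> kvec.span (I \<union> adapted \<beta> ` {(c, a). a \<in> E \<and> (\<exists>u\<in>U. c u \<noteq> 0)})"
    (is "_ \<subseteq> ?Z")
proof
  fix f assume "f \<in> ideal_gen (I \<union> lform \<beta> ` U)"
  then show "f \<in> ?Z"
    unfolding ideal_gen_def
  proof (induction rule: ideal.span_induct_alt)
    case base
    then show ?case by (simp add: kvec.span_zero)
  next
    case (step h x y)
    have "h * x \<in> ?Z"
    proof (cases "x \<in> I")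
      case True
      then show ?thesis by (intro kvec.span_base) (simp add: I_mult)
    next
      case False
      then obtain v where v: "v \<in> U" "x = lform \<beta> v"
        using step.hyps by auto
      have "lform \<beta> v * h \<in> ?Z"
        using spanned_UNIV[of h]
      proof (induction rule: kvec.span_induct_alt)
        case base
        then show ?case by (simp add: kvec.span_zero)
      next
        case (step k z w)
        have "lform \<beta> v * z \<in> I \<union> adapted \<beta> ` {(c, a). a \<in> E \<and> (\<exists>u\<in>U. c u \<noteq> 0)}"
        proof (cases "z \<in> I")
          case False
          then obtain c a where z: "z = adapted \<beta> (c, a)" and a: "a \<in> E"
            using step.hyps by auto
          have "lform \<beta> v * z = adapted \<beta> (c(v := Suc (c v)), a)"
            by (simp add: z lform_mult_adapted)
          moreover have "(c(v := Suc (c v)), a) \<in> {(c, a). a \<in> E \<and> (\<exists>u\<in>U. c u \<noteq> 0)}"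
            using v a by auto
          ultimately show ?thesis by blast
        qed (simp add: I_mult)
        then have "const k * (lform \<beta> v * z) + lform \<beta> v * w \<in> ?Z"
          by (rule kvec.span_add[OF kvec.span_scale[OF kvec.span_base] step.IH])
        also have "const k * (lform \<beta> v * z) + lform \<beta> v * w = lform \<beta> v * (const k * z + w)"
          by (simp add: algebra_simps)
        finally show ?case .
      qed
      then show ?thesis by (simp add: v mult.commute)
    qed
    then show ?case
      using step.IH by (intro kvec.span_add)
  qed
qed

text \<open>Products without any factor \<open>L\<^sub>u\<close>, \<open>u \<in> U\<close>, remain independent modulo the ideal generated by
  \<open>I\<close> and these \<open>L\<^sub>u\<close>: the two kinds of products are disjoint parts of a basis of \<open>R/I\<close>.\<close>

lemma adapted_disjoint:
  assumes K: "finite K" "K \<subseteq> UNIV \<times> E" and disj: "\<And>c a u. (c, a) \<in> K \<Longrightarrow> u \<in> U \<Longrightarrow> c u = 0"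
    and sum: "(\<Sum>p\<in>K. const (s p) * adapted \<beta> p) \<in> ideal_gen (I \<union> lform \<beta> ` U)"
    and p: "p \<in> K"
  shows "s p = 0"
proof -
  let ?P = "{(c, a). a \<in> E \<and> (\<exists>u\<in>U. c u \<noteq> 0)}"
  have "(\<Sum>p\<in>K. const (s p) * adapted \<beta> p) \<in> kvec.span (I \<union> adapted \<beta> ` ?P)"
    using sum ideal_gen_lforms_subset by blast
  then obtain x y where xy: "(\<Sum>p\<in>K. const (s p) * adapted \<beta> p) = x + y" "x \<in> I"
      "y \<in> kvec.span (adapted \<beta> ` ?P)"
    unfolding kvec.span_Un span_I by blast
  obtain L w where L: "finite L" "L \<subseteq> ?P" and y: "y = (\<Sum>p\<in>L. const (w p) * adapted \<beta> p)"
    using xy(3) by (rule span_image_sum)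
  have KL: "K \<inter> L = {}"
    using disj L(2) by fastforce
  \<comment> \<open>The coefficients of the relation obtained by moving \<open>y\<close> to the left-hand side.\<close>
  define t where "t q = (if q \<in> K then s q else - w q)" for q
  have "(\<Sum>p\<in>L. const (t p) * adapted \<beta> p) = (\<Sum>p\<in>L. - (const (w p) * adapted \<beta> p))"
    using KL by (intro sum.cong) (auto simp: t_def const_def single_uminus)
  then have "(\<Sum>p\<in>L. const (t p) * adapted \<beta> p) = - y"
    by (simp add: y sum_negf)
  moreover have "(\<Sum>p\<in>K. const (t p) * adapted \<beta> p) = x + y"
    unfolding xy(1)[symmetric] by (intro sum.cong) (auto simp: t_def)
  ultimately have "(\<Sum>p\<in>K \<union> L. const (t p) * adapted \<beta> p) = x"
    using K(1) L(1) KL by (simp add: sum.union_disjoint)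
  then have "t p = 0"
    using K L p xy(2) by (intro adapted_independent[of "K \<union> L" t p]) auto
  then show ?thesis
    using p by (simp add: t_def)
qed

text \<open>Expand \<open>g\<close> in the basis. The terms containing some \<open>L\<^sub>u\<close> with \<open>u \<in> U\<close> are in the ideal. Multiplication
  by \<open>L\<^sub>v\<close>, \<open>v \<notin> U\<close>, maps the other terms injectively to basis elements that again contain no such \<open>L\<^sub>u\<close>,
  so their coefficients are 0.\<close>

lemma lform_nonzerodivisor:
  assumes v: "v \<notin> U" and g: "lform \<beta> v * g \<in> ideal_gen (I \<union> lform \<beta> ` U)"
  shows "g \<in> ideal_gen (I \<union> lform \<beta> ` U)"
proof -
  let ?Q = "ideal_gen (I \<union> lform \<beta> ` U)"
  have Q: "ideal.subspace ?Q" by (rule is_ideal_ideal_gen)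
  have Q_base: "f \<in> ?Q" if "f \<in> I \<union> lform \<beta> ` U" for f
    using that by (simp add: ideal_gen_def ideal.span_base)
  have Q_mult: "h * f \<in> ?Q" if "f \<in> ?Q" for h f
    using that Q by (simp add: ideal.subspace_def)
  obtain x y where xy: "g = x + y" "x \<in> I" "y \<in> kvec.span (adapted \<beta> ` (UNIV \<times> E))"
    using spanned_UNIV[of g] unfolding kvec.span_Un span_I by blast
  obtain K s where K: "finite K" "K \<subseteq> UNIV \<times> E" and y: "y = (\<Sum>p\<in>K. const (s p) * adapted \<beta> p)"
    using xy(3) by (rule span_image_sum)
  define K0 where "K0 = {p\<in>K. \<forall>u\<in>U. fst p u = 0}"
  let ?y0 = "\<Sum>p\<in>K0. const (s p) * adapted \<beta> p"
  let ?y1 = "\<Sum>p\<in>K - K0. const (s p) * adapted \<beta> p"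
  have y_split: "y = ?y1 + ?y0"
    unfolding y using K(1) by (intro sum.subset_diff) (auto simp: K0_def)
  have "adapted \<beta> p \<in> ?Q" if pK: "p \<in> K - K0" for p
  proof -
    obtain u where u: "u \<in> U" "fst p u \<noteq> 0"
      using pK by (auto simp: K0_def)
    have "adapted \<beta> p = adapted \<beta> ((fst p)(u := fst p u - 1), snd p) * lform \<beta> u"
      using u(2) by (simp add: lform_mult_adapted mult.commute[of _ "lform \<beta> u"])
    then show ?thesis
      using u(1) by (simp add: Q_mult Q_base)
  qed
  then have y1: "?y1 \<in> ?Q"
    using Q_mult by (intro ideal.subspace_sum[OF Q]) auto
  have x: "x \<in> ?Q"
    using xy(2) Q_base by simp
  \<comment> \<open>The effect of multiplication by \<open>L\<^sub>v\<close> on the index of a basis element, and its inverse.\<close>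
  let ?sh = "\<lambda>p :: ('r \<Rightarrow> nat) \<times> ('r \<Rightarrow> nat). ((fst p)(v := Suc (fst p v)), snd p)"
  let ?un = "\<lambda>p :: ('r \<Rightarrow> nat) \<times> ('r \<Rightarrow> nat). ((fst p)(v := fst p v - 1), snd p)"
  have un: "?un (?sh p) = p" for p by simp
  have inj: "inj_on ?sh K0"
    by (rule inj_on_inverseI[where g = ?un]) (rule un)
  have "lform \<beta> v * ?y0 = lform \<beta> v * g - (lform \<beta> v * x + lform \<beta> v * ?y1)"
    by (simp add: xy(1) y_split algebra_simps)
  also have "\<dots> \<in> ?Q"
    using g Q_mult[OF x] Q_mult[OF y1] by (intro ideal.subspace_diff[OF Q] ideal.subspace_add[OF Q])
  also have "lform \<beta> v * ?y0 = (\<Sum>p\<in>K0. const (s p) * adapted \<beta> (?sh p))"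
    unfolding sum_distrib_left
  proof (rule sum.cong[OF refl])
    show "lform \<beta> v * (const (s p) * adapted \<beta> p) = const (s p) * adapted \<beta> (?sh p)" for p
      using lform_mult_adapted[of \<beta> v "fst p" "snd p"]
      by (simp add: mult.left_commute[of "lform \<beta> v"])
  qed
  also have "\<dots> = (\<Sum>p\<in>?sh ` K0. const (s (?un p)) * adapted \<beta> p)"
    by (simp add: sum.reindex[OF inj])
  finally have mem: "(\<Sum>p\<in>?sh ` K0. const (s (?un p)) * adapted \<beta> p) \<in> ?Q" .
  have "s p = 0" if p: "p \<in> K0" for p
  proof -
    have "s (?un (?sh p)) = 0"
    proof (rule adapted_disjoint[OF _ _ _ mem])
      show "finite (?sh ` K0)" using K(1) by (simp add: K0_def)
      show "?sh ` K0 \<subseteq> UNIV \<times> E" using K(2) by (auto simp: K0_def)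
      show "c u = 0" if "(c, a) \<in> ?sh ` K0" "u \<in> U" for c a u
        using that v by (auto simp: K0_def)
      show "?sh p \<in> ?sh ` K0" using p by blast
    qed
    then show ?thesis by simp
  qed
  then have "?y0 = 0" by simp
  then show ?thesis
    using ideal.subspace_add[OF Q x y1] by (simp add: xy(1) y_split)
qed

text \<open>Otherwise the constants, which are the forms of degree 0, would lie in \<open>I\<close>.\<close>

lemma zero_in_E: "(\<lambda>_. 0) \<in> E"
proof (rule ccontr)
  assume "(\<lambda>_. 0) \<notin> E"
  moreover have "a = (\<lambda>_. 0)" if "(\<lambda>_. 0) = (\<lambda>v. c v + a v)" for c a :: "'r \<Rightarrow> nat"
    using fun_cong[OF that] by (intro ext) simp
  ultimately have "adapted_set \<beta> E (\<lambda>_. 0) = {}"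
    unfolding adapted_set_def by blast
  then have "1 \<in> I"
    using spanned[of "\<lambda>_. 0"] one_in_forms span_I by auto
  then have "h \<in> I" for h
    using I_mult[of 1 h] by simp
  then show False
    using proper by auto
qed

lemma ideal_gen_lforms_proper: "ideal_gen (I \<union> lform \<beta> ` U) \<noteq> UNIV"
proof
  assume "ideal_gen (I \<union> lform \<beta> ` U) = UNIV"
  then have "(\<Sum>p\<in>{(\<lambda>_. 0, \<lambda>_. 0)}. const 1 * adapted \<beta> p) \<in> ideal_gen (I \<union> lform \<beta> ` U)"
    by simp
  then have "(1 :: 'k) = 0"
    by (rule adapted_disjoint[rotated 3]) (use zero_in_E in auto)
  then show False by simp
qed

lemma depth_ge_card: "enat (CARD('r)) \<le> depth I"
proof -
  obtain vs :: "'r list" where vs: "set vs = UNIV" "distinct vs"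
    using finite_distinct_list[OF finite] by blast
  let ?fs = "map (lform \<beta>) vs"
  have len: "length ?fs = CARD('r)"
    using vs distinct_card by fastforce
  have "regular_seq I ?fs"
    unfolding regular_seq_def
  proof (intro conjI allI impI)
    fix n g assume n: "n < length ?fs" and g: "?fs ! n * g \<in> ideal_gen (I \<union> set (take n ?fs))"
    have eq: "set (take n ?fs) = lform \<beta> ` set (take n vs)"
      by (simp add: take_map)
    have "vs ! n \<notin> set (take n vs)"
      using vs(2) n by (auto simp: in_set_conv_nth nth_eq_iff_index_eq)
    then show "g \<in> ideal_gen (I \<union> set (take n ?fs))"
      using g n lform_nonzerodivisor unfolding eq by simp
  qed (use ideal_gen_lforms_proper[of UNIV] vs in simp)
  moreover have "set ?fs \<subseteq> ideal_gen (range var)"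
  proof -
    have "lform \<beta> v \<in> ideal_gen (range var)" for v
      unfolding lform_def ideal_gen_def
      by (intro ideal.span_diff ideal.span_scale ideal.span_base) auto
    then show ?thesis by auto
  qed
  ultimately have "enat (length ?fs) \<le> depth I"
    unfolding depth_def by (intro SUP_upper) auto
  then show ?thesis by (simp only: len)
qed

end

section \<open>From the difference function to the depth\<close>

text \<open>For \<open>a \<le> b\<close> there is the monomial with exponents \<open>a v\<close> and \<open>b v - a v\<close> on the factor \<open>v\<close>.\<close>

lemma card_le_dim_forms:
  "card {a :: 'r::finite \<Rightarrow> nat. a \<le> b} \<le> kvec.dim (forms fst b :: ('r \<times> 2, 'k::field) mpoly set)"
  unfolding dim_forms
proof (rule card_inj_on_le[OF _ _ finite_mdeg])
  let ?m = "\<lambda>a. Poly_Mapping.Abs_poly_mapping (\<lambda>(v, j). if j = 0 then a v else b v - a v) :: 'r \<times> 2 \<Rightarrow>\<^sub>0 nat"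
  show "inj_on ?m {a. a \<le> b}"
  proof (rule inj_onI, rule ext)
    fix a a' v assume "?m a = ?m a'"
    then have "Poly_Mapping.lookup (?m a) (v, 0) = Poly_Mapping.lookup (?m a') (v, 0)"
      by simp
    then show "a v = a' v" by simp
  qed
  show "?m ` {a. a \<le> b} \<subseteq> {m. mdeg fst m = b}"
    by (auto simp: mdeg_fst le_fun_def)
qed


text \<open>The degree \<open>b\<close> itself is counted by the dimension of the forms of degree \<open>b\<close>, but not by the
  Hilbert function. So the two differ and \<open>I\<close> has a nonzero form in this degree.\<close>

lemma exists_form_in_ideal:
  fixes I :: "('r::finite \<times> 2, 'k::field) mpoly set"
  assumes I: "ideal.subspace I" and H: "hilbert_fun fst I b = card {a\<in>E. a \<le> b}" and b: "b \<notin> E"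
  shows "\<exists>f. f \<in> I \<and> f \<in> forms fst b \<and> f \<noteq> 0"
proof (rule ccontr)
  assume "\<not> ?thesis"
  then have "I \<inter> forms fst b \<subseteq> kvec.span {}" by auto
  then have "kvec.dim (I \<inter> forms fst b) \<le> card ({} :: ('r \<times> 2, 'k) mpoly set)"
    by (intro kvec.dim_le_card) auto
  then have "kvec.dim (forms fst b :: ('r \<times> 2, 'k) mpoly set) = card {a\<in>E. a \<le> b}"
    using hilbert_fun_add_dim[OF I, of fst b] H by simp
  moreover have "card {a\<in>E. a \<le> b} < card {a. a \<le> b}"
    using b by (intro psubset_card_mono finite_le_fun) auto
  ultimately show False
    using card_le_dim_forms[of b, where 'k = 'k] by simp
qed

text \<open>The Hilbert function determines the degrees of the basis over \<open>k[L\<^sub>1, \<dots>, L\<^sub>r]\<close>, namely \<open>E\<close>; what has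
  to be chosen is the point \<open>\<beta>\<close>, for which a form of \<open>I\<close> not vanishing there is required below each
  degree outside \<open>E\<close>.\<close>

lemma first_diff_indicator_imp_depth:
  fixes I :: "('r::finite \<times> 2, 'k::field_char_0) mpoly set"
  assumes I: "multihomogeneous_ideal fst I" and proper: "I \<noteq> UNIV" and fin: "finite E"
    and diff: "\<And>i. first_diff (hilbert_fun fst I) i = (if i \<in> E then 1 else 0)"
  shows "enat (CARD('r)) \<le> depth I"
proof -
  have idl: "ideal.subspace I"
    using I by (rule multihomogeneous_is_ideal)
  have H: "hilbert_fun fst I d = card {a\<in>E. a \<le> d}" for d
    by (rule first_diff_inject) (simp add: diff first_diff_count[OF fin])
  \<comment> \<open>\<open>N\<close> exceeds all entries of elements of \<open>E\<close>. Truncating a degree \<open>i \<notin> E\<close> at \<open>N\<close> gives a degree that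
    is at most \<open>i\<close> and still not in \<open>E\<close>: it is \<open>i\<close> or it has an entry \<open>N\<close>. So forms in the finitely many
    degrees up to \<open>N\<close> suffice.\<close>
  define N where "N = Suc (\<Sum>a\<in>E. \<Sum>v\<in>UNIV. a v)"
  have lessN: "a v < N" if "a \<in> E" for a v
  proof -
    have "a v \<le> (\<Sum>v\<in>UNIV. a v)" by (rule member_le_sum) auto
    also have "\<dots> \<le> (\<Sum>a\<in>E. \<Sum>v\<in>UNIV. a v)"
      using fin that by (intro member_le_sum[of a E "\<lambda>a. \<Sum>v\<in>UNIV. a v"]) auto
    finally show ?thesis by (simp add: N_def)
  qed
  have "\<forall>b. \<exists>f. b \<notin> E \<longrightarrow> f \<in> I \<and> f \<in> forms fst b \<and> f \<noteq> 0"
    using exists_form_in_ideal[OF idl H] by blast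
  then obtain F where F: "\<And>b. b \<notin> E \<Longrightarrow> F b \<in> I \<and> F b \<in> forms fst b \<and> F b \<noteq> 0"
    by metis
  let ?B = "F ` ({b. b \<le> (\<lambda>_. N)} - E)"
  have "\<exists>\<beta>. \<forall>f\<in>?B. eval f (affine_pt \<beta>) \<noteq> 0"
  proof (rule generic_point)
    show "finite ?B" by (intro finite_imageI finite_Diff finite_le_fun)
    show "f \<noteq> 0 \<and> (\<exists>d. f \<in> forms fst d \<and> (\<forall>v. d v \<le> N))" if "f \<in> ?B" for f
      using that F by (auto simp: le_fun_def)
  qed
  then obtain \<beta> where \<beta>: "\<And>b. b \<le> (\<lambda>_. N) \<Longrightarrow> b \<notin> E \<Longrightarrow> eval (F b) (affine_pt \<beta>) \<noteq> 0"
    by blast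
  have "\<exists>b f. b \<le> i \<and> f \<in> I \<and> f \<in> forms fst b \<and> eval f (affine_pt \<beta>) \<noteq> 0" if i: "i \<notin> E" for i
  proof -
    let ?b = "\<lambda>v. min (i v) N"
    have "?b \<notin> E"
    proof (cases "i \<le> (\<lambda>_. N)")
      case True
      then have "?b = i" by (auto simp: le_fun_def min_def)
      then show ?thesis using i by simp
    next
      case False
      then obtain v where "N < i v"
        by (auto simp: le_fun_def not_le)
      then have "?b v = N" by simp
      then show ?thesis using lessN[of ?b v] by auto
    qed
    then show ?thesis
      using F[of ?b] \<beta>[of ?b] by (intro exI[of _ ?b] exI[of _ "F ?b"]) (auto simp: le_fun_def)
  qed
  then interpret adapted_quotient I E \<beta>
    using forms_spanned_by_adapted[OF idl] I proper fin H by unfold_locales auto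
  show ?thesis by (rule depth_ge_card)
qed

theorem theorem3p7:
  fixes X :: "('r::finite \<Rightarrow> (2 \<Rightarrow> 'k::{alg_closed_field, field_char_0}) set) set"
  assumes "CARD('r) \<ge> 2"
    and "finite X"
    and "X \<subseteq> multiproj"
    and "depth (vanishing_ideal X) = enat (CARD('r) - 1)"
  shows "\<not> (\<exists>J :: ('r, 'k) mpoly set.
      multihomogeneous_ideal id J \<and> artinian_quotient J \<and>
      (\<forall>i. first_diff (hilbert_points X) i = int (hilbert_fun id J i)))"
proof
  assume "\<exists>J :: ('r, 'k) mpoly set.
      multihomogeneous_ideal id J \<and> artinian_quotient J \<and>
      (\<forall>i. first_diff (hilbert_points X) i = int (hilbert_fun id J i))"
  then obtain J :: "('r, 'k) mpoly set" where J: "multihomogeneous_ideal id J" "artinian_quotient J"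
    and diff: "\<And>i. first_diff (hilbert_points X) i = int (hilbert_fun id J i)"
    by blast
  let ?I = "vanishing_ideal X"
  have "multihomogeneous_ideal fst ?I"
    unfolding multihomogeneous_ideal_def vanishing_ideal_def by (intro exI conjI refl) auto
  \<comment> \<open>The depth of the zero ring is the supremum of the empty set, which is 0, whereas here it is
    at least 1.\<close>
  moreover have "?I \<noteq> UNIV"
  proof
    assume "?I = UNIV"
    then have "\<not> regular_seq ?I fs" for fs
      using ideal.span_superset[of "UNIV :: ('r \<times> 2, 'k) mpoly set"]
      by (auto simp: regular_seq_def ideal_gen_def)
    then have "depth ?I = 0"
      by (simp add: depth_def bot_enat_def)
    then show False
      using assms(1,4) by (simp add: zero_enat_def)
  qed
  moreover have "finite {i. hilbert_fun id J i \<noteq> 0}"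
    by (rule artinian_hilbert_fun[OF J])
  moreover have "first_diff (hilbert_fun fst ?I) i
      = (if i \<in> {i. hilbert_fun id J i \<noteq> 0} then 1 else 0)" for i
    using diff[of i] artinian_hilbert_fun(2)[OF J, of i] by (auto simp: hilbert_points_def le_Suc_eq)
  ultimately have "enat (CARD('r)) \<le> depth ?I"
    by (rule first_diff_indicator_imp_depth)
  then show False
    using assms(1,4) by simp
qed

end
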